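(* Let $k$ be an even positive integer, $N$ a positive integer, and $\frac{p}{q}$ (with $\gcd(p,q)=1$, $q>0$) a rational number which is $\Gamma_0(N)$-equivalent to the cusp $i\infty$ and satisfies $p^2\equiv 1 \pmod q$. Let $f\in S_k(\Gamma_0(N))$ have Fourier expansion \[f(z)=\sum_{n\geq 1} a_n n^{\frac{k-1}{2}}e(nz),\] with $a_1\neq 0$ and $a_j\in\mathbb R$ for all $j$. Then the additively twisted $L$-function $L_{p/q}(s,f)$ has infinitely many zeros on the critical line $\mathrm{Re}\, s=\frac12$.
   Context: $e(z)=e^{2\pi i z}$. $S_k(\Gamma_0(N))$ is the space of holomorphic cusp forms of weight $k$ for $\Gamma_0(N)$. A rational $p/q$ is $\Gamma_0(N)$-equivalent to $i\infty$ if $p/q=\gamma(i\infty)$ for some $\gamma\in\Gamma_0(N)$. The additively twisted $L$-function is $L_{p/q}(s,f)=\sum_{n\geq1} a_n e(np/q)n^{-s}$ (convergent for $\mathrm{Re}\, s$ large, and continued analytically to all of $\mathbb C$); with this normalization the critical line is $\mathrm{Re}\,s=\frac12$. *)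

theory Defs
  imports "HOL-Complex_Analysis.Complex_Analysis" "HOL-Number_Theory.Cong"
begin

definition upper_half_plane :: "complex set" where
  "upper_half_plane = {z. Im z > 0}"

definition SL2Z :: "(int^2^2) set" where
  "SL2Z = {A. det A = 1}"

definition Gamma0 :: "nat \<Rightarrow> (int^2^2) set" where
  "Gamma0 N = {A \<in> SL2Z. int N dvd A $ 2 $ 1}"

definition moebius :: "int^2^2 \<Rightarrow> complex \<Rightarrow> complex" where
  "moebius A z = (of_int (A $ 1 $ 1) * z + of_int (A $ 1 $ 2)) /
                 (of_int (A $ 2 $ 1) * z + of_int (A $ 2 $ 2))"

text \<open>
  The image of $i\infty$ under a matrix with first column $(a, c)$ is $a/c$; it is again
  $i\infty$, and in particular not a rational number, iff $c = 0$.
\<close>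
definition Gamma0_equiv_infinity :: "nat \<Rightarrow> rat \<Rightarrow> bool" where
  "Gamma0_equiv_infinity N x \<longleftrightarrow>
     (\<exists>A\<in>Gamma0 N. A $ 2 $ 1 \<noteq> 0 \<and> x = of_int (A $ 1 $ 1) / of_int (A $ 2 $ 1))"

definition slash :: "nat \<Rightarrow> int^2^2 \<Rightarrow> (complex \<Rightarrow> complex) \<Rightarrow> complex \<Rightarrow> complex" where
  "slash k A f z = f (moebius A z) / (of_int (A $ 2 $ 1) * z + of_int (A $ 2 $ 2)) ^ k"

text \<open>
  Only the values on the upper half plane matter; those elsewhere are unconstrained.
  Since every cusp is $A(i\infty)$ for some $A$ in $SL_2(\mathbb{Z})$, the last clause says
  that \<open>f\<close> vanishes at every cusp. The limit is taken as $\mathrm{Im}\,z \to \infty$,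
  uniformly in $\mathrm{Re}\,z$.
\<close>
definition cusp_forms :: "nat \<Rightarrow> nat \<Rightarrow> (complex \<Rightarrow> complex) set" where
  "cusp_forms k N = {f.
     f holomorphic_on upper_half_plane \<and>
     (\<forall>A\<in>Gamma0 N. \<forall>z\<in>upper_half_plane. slash k A f z = f z) \<and>
     (\<forall>A\<in>SL2Z. (slash k A f \<longlongrightarrow> 0) (filtercomap Im at_top))}"

definition e2pii :: "complex \<Rightarrow> complex" where
  "e2pii z = exp (2 * of_real pi * \<i> * z)"

text \<open>Series over $n \geq 1$ are indexed by \<open>Suc n\<close>; the value \<open>a 0\<close> is never used.\<close>
definition has_normalized_fourier_expansion ::
    "nat \<Rightarrow> (complex \<Rightarrow> complex) \<Rightarrow> (nat \<Rightarrow> complex) \<Rightarrow> bool" where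
  "has_normalized_fourier_expansion k f a \<longleftrightarrow>
     (\<forall>z\<in>upper_half_plane.
        (\<lambda>n. a (Suc n) * of_real (real (Suc n) powr ((real k - 1) / 2)) * e2pii (of_nat (Suc n) * z))
        sums f z)"

definition continues_twisted_series ::
    "(nat \<Rightarrow> complex) \<Rightarrow> rat \<Rightarrow> (complex \<Rightarrow> complex) \<Rightarrow> bool" where
  "continues_twisted_series a x L \<longleftrightarrow>
     L holomorphic_on UNIV \<and>
     (\<exists>\<sigma>::real. \<forall>s. Re s > \<sigma> \<longrightarrow>
        (\<lambda>n. a (Suc n) * e2pii (of_nat (Suc n) * of_rat x) * of_nat (Suc n) powr (- s)) sums L s)"

lemma continues_twisted_series_unique:
  assumes "continues_twisted_series a x L" "continues_twisted_series a x M"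
  shows "L = M"
proof -
  obtain \<sigma> \<tau> where L: "L holomorphic_on UNIV" and M: "M holomorphic_on UNIV"
    and eq: "\<And>s. Re s > \<sigma> \<Longrightarrow> Re s > \<tau> \<Longrightarrow> L s = M s"
    using assms sums_unique2 unfolding continues_twisted_series_def by meson
  define U where "U = {s. Re s > max \<sigma> \<tau>}"
  have U: "open U" unfolding U_def by (rule open_halfspace_Re_gt)
  have "of_real (max \<sigma> \<tau> + 1) \<in> U" unfolding U_def by (simp add: less_max_iff_disj max_def)
  then have "U \<noteq> {}" by blast
  then have "L s = M s" for s
    using analytic_continuation_open[of U UNIV L M s] U L M eq by (auto simp: U_def)
  then show ?thesis by auto
qed

text \<open>The twisted L-function, as an entire function of \<open>s\<close>.\<close>
definition twisted_L :: "(nat \<Rightarrow> complex) \<Rightarrow> rat \<Rightarrow> complex \<Rightarrow> complex" where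
  "twisted_L a x = (THE L. continues_twisted_series a x L)"

end

theory Submission
  imports Defs "HOL-Probability.Characteristic_Functions" "HOL-Real_Asymp.Real_Asymp"
begin

text \<open>
  Since $p^2 \equiv 1 \pmod q$ and $N \mid q$, the matrix $(p, (p^2-1)/q; q, p)$ lies in $\Gamma_0(N)$.
  Write $k = 2m$, $z = p/q + i e^u/q$ and $\Phi(u) = (i e^u)^m f(z)$ for $|\mathrm{Im}\,u| < \pi/2$. As
  the $a_j$ are real, that matrix gives $\Phi(-u) = \overline{\Phi(\overline u)}$, so that
  $h(t) = \int \Phi(v) e^{itv}\,dv$ is real; and $h(t)$ is $L_{p/q}(1/2+it, f)$ times a nonvanishing
  Gamma factor.

  Shifting the contour, $h(t) e^{t\theta}$ is the Fourier transform of $v \mapsto \Phi(v + i\theta)$,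
  hence $\int h(t) e^{t\theta}\,dt = 2\pi\,\Phi(i\theta)$. For $\theta \to \pi/2$ the point $z$ tends
  to a cusp, where $f$ decays exponentially, so the right-hand side stays bounded. If $h$ had finitely
  many zeros, it would have constant sign for large $t$, and monotone convergence would make
  $h(t) e^{t\pi/2}$ integrable on the half-line $t > 0$. Then $\Phi$ extends continuously to the line
  $\mathrm{Im}\,u = \pi/2$, where it vanishes at the dense set of $v$ with rational $e^v$, again by decay
  at the cusps. By the Schwarz reflection principle $\Phi = 0$, which contradicts $a_1 \neq 0$.
\<close>

section \<open>Fourier and Mellin integrals\<close>

text \<open>The obstacle is the boundary. The segment u = v + i\<theta> ends at the point (p -
  e^v)/q, which is rational exactly when e^v is; only there is a limit of f available, and only for
  non-tangential approach. The constant sign of h bridges this gap: the bound on the single segment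
  v = 0 becomes absolute integrability, that gives continuity on the whole boundary line, and then a
  countable dense set of zeros suffices. The divisibility N | q holds because p/q is the first
  column of a matrix in \<Gamma>0(N), so that N divides its reduced denominator. The exponent m =
  k/2 in \<Phi> makes the automorphy factor of the matrix cancel against the prefactors, and the
  same m, together with the normalisation n^((k-1)/2), puts the axis of symmetry at Re s = 1/2.
  Identifying h with the L-function needs a half plane where the Dirichlet series converges
  absolutely. A coarse polynomial bound for f near the real axis provides it, and this is where all
  cosets of \<Gamma>0(N) enter at once.\<close>

lemma std_normal_fourier:
  "(LINT s|lborel. of_real (std_normal_density s) * cis (t * s)) = of_real (exp (-(t\<^sup>2) / 2))"
proof -
  have "char std_normal_distribution t = of_real (exp (-(t\<^sup>2) / 2))"
    by (simp add: char_std_normal_distribution)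
  then show ?thesis
    by (simp add: char_def integral_density cis_conv_exp scaleR_conv_of_real)
qed

lemma integrable_mult_cis:
  fixes G :: "real \<Rightarrow> complex"
  assumes "integrable lborel G"
  shows "integrable lborel (\<lambda>v. G v * cis (t * v))"
proof (rule Bochner_Integration.integrable_bound[OF assms])
  show "(\<lambda>v. G v * cis (t * v)) \<in> borel_measurable lborel"
    using borel_measurable_integrable[OF assms] unfolding cis_conv_exp by measurable
qed (simp add: norm_mult)

text \<open>A Gaussian factor of width 1/\<sigma> makes the double integral absolutely convergent,
  so Fubini applies; its transform is again a Gaussian, which concentrates at 0 as \<sigma> tends to
  0. The value at 0 is enough, since other points are reached by translating
  \<open>G\<close>.\<close>

theorem fourier_inversion_at_0:
  fixes G :: "real \<Rightarrow> complex"
  defines "H \<equiv> \<lambda>t. LINT v|lborel. G v * cis (t * v)"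
  assumes cont: "continuous_on UNIV G" and bdd: "\<And>x. norm (G x) \<le> B"
    and int: "integrable lborel G" and inth: "integrable lborel H"
  shows "(LINT t|lborel. H t) = 2 * pi * G 0"
proof -
  define g where "g = std_normal_density"
  have Gm [measurable]: "G \<in> borel_measurable borel" using int by measurable
  have Hm [measurable]: "H \<in> borel_measurable borel" using inth by measurable
  have gm [measurable]: "g \<in> borel_measurable borel" unfolding g_def by simp
  have gi: "integrable lborel g" unfolding g_def by simp
  have gint: "(LINT x|lborel. of_real (g x) :: complex) = 1"
    unfolding g_def using std_normal_fourier[of 0] by simp
  have key: "(LINT t|lborel. H t * of_real (sqrt (2 * pi) * g (\<sigma> * t)))
      = 2 * pi * (LINT x|lborel. of_real (g x) * G (\<sigma> * x))" if s: "\<sigma> > 0" for \<sigma>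
  proof -
    have e: "exp (-((v / \<sigma>)\<^sup>2) / 2) = sqrt (2 * pi) * g (v / \<sigma>)" for v
      unfolding g_def normal_density_def by simp
    have meas: "(\<lambda>(s, v). of_real (g s) * (G v * cis (v / \<sigma> * s))) \<in> borel_measurable (lborel \<Otimes>\<^sub>M lborel)"
      unfolding cis_conv_exp by measurable
    have "integrable (lborel \<Otimes>\<^sub>M lborel) (\<lambda>(s, v). of_real (g s) * (G v * cis (v / \<sigma> * s)))"
    proof (rule lborel_pair.Fubini_integrable[OF meas])
      have "(\<lambda>s. LINT v|lborel. norm (of_real (g s) * (G v * cis (v / \<sigma> * s)))) =
          (\<lambda>s. \<bar>g s\<bar> * (LINT v|lborel. norm (G v)))"
        by (simp add: norm_mult)
      then show "integrable lborel (\<lambda>s. LINT v|lborel. norm (case (s, v) of (s, v) \<Rightarrow> of_real (g s) * (G v * cis (v / \<sigma> * s))))"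
        using gi by simp
      have "integrable lborel (\<lambda>v. of_real (g s) * (G v * cis (v / \<sigma> * s)))" for s
        using integrable_mult_cis[OF int, of "s / \<sigma>"] by (simp add: mult.commute)
      then show "AE s in lborel. integrable lborel (\<lambda>v. case (s, v) of (s, v) \<Rightarrow> of_real (g s) * (G v * cis (v / \<sigma> * s)))"
        by simp
    qed
    from lborel_pair.Fubini_integral[OF this]
    have fub: "(LINT v|lborel. LINT s|lborel. of_real (g s) * (G v * cis (v / \<sigma> * s)))
      = (LINT s|lborel. LINT v|lborel. of_real (g s) * (G v * cis (v / \<sigma> * s)))" by simp
    have L: "(LINT s|lborel. LINT v|lborel. of_real (g s) * (G v * cis (v / \<sigma> * s)))
       = (LINT s|lborel. of_real (g s) * H (s / \<sigma>))"
      unfolding H_def by (simp add: mult.commute)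
    have R: "(LINT v|lborel. LINT s|lborel. of_real (g s) * (G v * cis (v / \<sigma> * s)))
       = (LINT v|lborel. G v * of_real (sqrt (2 * pi) * g (v / \<sigma>)))"
    proof -
      have "(LINT s|lborel. of_real (g s) * (G v * cis (v / \<sigma> * s)))
        = G v * (LINT s|lborel. of_real (g s) * cis (v / \<sigma> * s))" for v
        by (subst integral_mult_right_zero[symmetric]) (simp add: mult_ac)
      then have "(LINT s|lborel. of_real (g s) * (G v * cis (v / \<sigma> * s)))
        = G v * of_real (sqrt (2 * pi) * g (v / \<sigma>))" for v
        using std_normal_fourier[of "v / \<sigma>"] e[of v] unfolding g_def by metis
      then show ?thesis by presburger
    qed
    have "(LINT s|lborel. of_real (g s) * H (s / \<sigma>)) = \<sigma> * (LINT t|lborel. of_real (g (\<sigma> * t)) * H t)"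
      using lborel_integral_real_affine[of \<sigma> "\<lambda>s. of_real (g s) * H (s / \<sigma>)" 0] s
      by (simp add: scaleR_conv_of_real)
    moreover have "(LINT v|lborel. G v * of_real (sqrt (2 * pi) * g (v / \<sigma>)))
       = \<sigma> * (LINT x|lborel. G (\<sigma> * x) * of_real (sqrt (2 * pi) * g x))"
      using lborel_integral_real_affine[of \<sigma> "\<lambda>v. G v * of_real (sqrt (2 * pi) * g (v / \<sigma>))" 0] s
      by (simp add: scaleR_conv_of_real)
    ultimately have *: "(LINT t|lborel. of_real (g (\<sigma> * t)) * H t) = (LINT x|lborel. G (\<sigma> * x) * of_real (sqrt (2 * pi) * g x))"
      using fub L R s by simp
    have "(LINT t|lborel. H t * of_real (sqrt (2 * pi) * g (\<sigma> * t))) =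
       of_real (sqrt (2 * pi)) * (LINT t|lborel. of_real (g (\<sigma> * t)) * H t)"
      by (subst integral_mult_right_zero[symmetric]) (simp add: mult_ac)
    also have "\<dots> = of_real (sqrt (2 * pi)) * (LINT x|lborel. of_real (sqrt (2 * pi)) * (of_real (g x) * G (\<sigma> * x)))"
      by (subst *) (simp add: mult_ac)
    also have "\<dots> = (of_real (sqrt (2 * pi)) * of_real (sqrt (2 * pi))) * (LINT x|lborel. of_real (g x) * G (\<sigma> * x))"
      by simp
    also have "of_real (sqrt (2 * pi)) * of_real (sqrt (2 * pi)) = (2 * pi :: complex)"
      by (simp flip: of_real_mult)
    finally show ?thesis .
  qed
  define \<sigma> where "\<sigma> = (\<lambda>n. 1 / real (Suc n))"
  have s0: "\<sigma> \<longlonglongrightarrow> 0" unfolding \<sigma>_def by real_asymp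
  have spos: "\<sigma> n > 0" for n by (simp add: \<sigma>_def)
  \<comment> \<open>\<open>sqrt (2 * pi) * g\<close> is the Gaussian scaled to be 1 at the origin,
    so the damping tends to 1 pointwise and never exceeds 1.\<close>
  have lim1: "(\<lambda>n. LINT t|lborel. H t * of_real (sqrt (2 * pi) * g (\<sigma> n * t))) \<longlonglongrightarrow> (LINT t|lborel. H t)"
  proof (rule integral_dominated_convergence[where w = "\<lambda>t. norm (H t)"])
    show "AE t in lborel. (\<lambda>n. H t * of_real (sqrt (2 * pi) * g (\<sigma> n * t))) \<longlonglongrightarrow> H t"
    proof (rule AE_I2)
      fix t
      have "(\<lambda>n. H t * of_real (exp (-((\<sigma> n * t)\<^sup>2) / 2))) \<longlonglongrightarrow> H t * of_real (exp (- ((0 * t)\<^sup>2) / 2))"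
        by (intro tendsto_intros s0) auto
      then show "(\<lambda>n. H t * of_real (sqrt (2 * pi) * g (\<sigma> n * t))) \<longlonglongrightarrow> H t"
        by (simp add: g_def normal_density_def)
    qed
    show "AE t in lborel. norm (H t * of_real (sqrt (2 * pi) * g (\<sigma> n * t))) \<le> norm (H t)" for n
      by (simp add: norm_mult g_def normal_density_def mult_left_le)
  qed (use inth in auto)
  have lim2: "(\<lambda>n. 2 * pi * (LINT x|lborel. of_real (g x) * G (\<sigma> n * x))) \<longlonglongrightarrow> 2 * pi * (LINT x|lborel. of_real (g x) * G 0)"
  proof (intro tendsto_intros, rule integral_dominated_convergence[where w = "\<lambda>x. g x * B"])
    show "AE x in lborel. (\<lambda>n. of_real (g x) * G (\<sigma> n * x)) \<longlonglongrightarrow> of_real (g x) * G 0"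
    proof (rule AE_I2)
      fix x
      have "isCont G 0" using cont by (simp add: continuous_on_eq_continuous_at)
      moreover have "(\<lambda>n. \<sigma> n * x) \<longlonglongrightarrow> 0" using tendsto_mult_right[OF s0, of x] by simp
      ultimately have "(\<lambda>n. G (\<sigma> n * x)) \<longlonglongrightarrow> G 0" using isCont_tendsto_compose by blast
      then show "(\<lambda>n. of_real (g x) * G (\<sigma> n * x)) \<longlonglongrightarrow> of_real (g x) * G 0" by (intro tendsto_intros)
    qed
    show "AE x in lborel. norm (of_real (g x) * G (\<sigma> n * x)) \<le> g x * B" for n
      using bdd by (auto simp: norm_mult g_def intro!: mult_left_mono)
  qed (use gi in auto)
  have "(LINT t|lborel. H t) = 2 * pi * (LINT x|lborel. of_real (g x) * G 0)"
    by (rule LIMSEQ_unique[OF lim1[unfolded key[OF spos]] lim2])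
  also have "(LINT x|lborel. of_real (g x) * G 0) = G 0"
    using gint by (subst integral_mult_left_zero) simp
  finally show ?thesis .
qed

lemma continuous_on_integral_dominated:
  fixes f :: "'a :: metric_space \<Rightarrow> 'b \<Rightarrow> 'c :: {banach, second_countable_topology}"
  assumes "\<And>t. t \<in> space M \<Longrightarrow> continuous_on S (\<lambda>u. f u t)"
    and "\<And>u. u \<in> S \<Longrightarrow> f u \<in> borel_measurable M"
    and "integrable M w" and "\<And>u t. u \<in> S \<Longrightarrow> t \<in> space M \<Longrightarrow> norm (f u t) \<le> w t"
  shows "continuous_on S (\<lambda>u. LINT t|M. f u t)"
  unfolding continuous_on_sequentially
proof (intro allI ballI impI, elim conjE)
  fix x a assume a: "a \<in> S" and x: "\<forall>n. x n \<in> S" and lim: "x \<longlonglongrightarrow> a"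
  show "((\<lambda>u. LINT t|M. f u t) \<circ> x) \<longlonglongrightarrow> (LINT t|M. f a t)"
    unfolding o_def
  proof (rule integral_dominated_convergence[where w = w])
    show "AE t in M. (\<lambda>n. f (x n) t) \<longlonglongrightarrow> f a t"
      using assms(1) a x lim unfolding continuous_on_sequentially o_def by (intro AE_I2) blast
  qed (use assms a x in auto)
qed

section \<open>Horizontal contour shifts in a strip\<close>

lemma integrable_exp_minus_abs: "integrable lborel (\<lambda>x::real. exp (- \<bar>x\<bar>))"
proof -
  have *: "integrable lborel (\<lambda>x::real. exp (- x) * indicator {0..} x)"
  proof (rule integrableI_nonneg)
    have "(\<integral>\<^sup>+x. ennreal (exp (- x) * indicator {0..} x) \<partial>lborel) =
        (\<integral>\<^sup>+x. ennreal (x ^ 0 * exp (- x)) * indicator {0..} x \<partial>lborel)"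
      by (intro nn_integral_cong) (auto simp: indicator_def)
    then show "(\<integral>\<^sup>+x. ennreal (exp (- x) * indicator {0..} x) \<partial>lborel) < \<infinity>"
      by (simp only: nn_intergal_power_times_exp_Ici) simp
  qed auto
  have "integrable lborel (\<lambda>x::real. exp (- x) * indicator {0..} x + exp (- (0 + (-1) * x)) * indicator {0..} (0 + (-1) * x))"
    by (rule Bochner_Integration.integrable_add[OF * lborel_integrable_real_affine[OF *]]) simp
  then show ?thesis
    by (rule Bochner_Integration.integrable_bound) (auto simp: indicator_def)
qed

text \<open>Cauchy's theorem for a rectangle whose vertical sides recede to infinity, phrased
  through a primitive \<open>P\<close> on the convex strip: each horizontal integral is a difference
  of values of \<open>P\<close>, and each vertical side is bounded by its length times the decay of
  \<psi>.\<close>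

lemma contour_shift:
  fixes \<psi> :: "complex \<Rightarrow> complex"
  assumes holo: "\<psi> holomorphic_on {u. \<bar>Im u\<bar> < b}" and th: "\<bar>\<theta>\<bar> < b"
    and bound: "\<And>u. \<bar>Im u\<bar> \<le> \<bar>\<theta>\<bar> \<Longrightarrow> norm (\<psi> u) \<le> C * exp (- \<bar>Re u\<bar>)"
  shows "(LINT v|lborel. \<psi> (Complex v \<theta>)) = (LINT v|lborel. \<psi> (of_real v))"
proof -
  define S where "S = {u. \<bar>Im u\<bar> < b}"
  have S_eq: "S = {u. Im u < b} \<inter> {u. Im u > - b}" by (auto simp: S_def)
  have "convex S" unfolding S_eq by (intro convex_Int convex_halfspace_Im_lt convex_halfspace_Im_gt)
  have "open S" unfolding S_eq by (intro open_Int open_halfspace_Im_lt open_halfspace_Im_gt)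
  obtain P where P: "\<And>u. u \<in> S \<Longrightarrow> (P has_field_derivative \<psi> u) (at u within S)"
    using holomorphic_convex_primitive'[OF \<open>convex S\<close> \<open>open S\<close>] holo unfolding S_def by blast
  have P': "(P has_field_derivative \<psi> u) (at u)" if "u \<in> S" for u
    using P[OF that] at_within_open[OF that \<open>open S\<close>] by simp
  have contS: "continuous_on S \<psi>" using holo holomorphic_on_imp_continuous_on S_def by blast
  have line: "(\<lambda>n. P (Complex (real n) \<tau>) - P (Complex (- real n) \<tau>)) \<longlonglongrightarrow> (LINT v|lborel. \<psi> (Complex v \<tau>))"
    if tau: "\<bar>\<tau>\<bar> \<le> \<bar>\<theta>\<bar>" for \<tau>
  proof -
    have inS: "Complex v \<tau> \<in> S" for v using tau th by (simp add: S_def)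
    have cont: "continuous_on A (\<lambda>v. \<psi> (Complex v \<tau>))" for A
      unfolding Complex_eq
      by (rule continuous_on_compose2[OF contS]) (use inS in \<open>auto intro!: continuous_intros simp: Complex_eq\<close>)
    have meas [measurable]: "(\<lambda>v. \<psi> (Complex v \<tau>)) \<in> borel_measurable borel"
      using cont by (rule borel_measurable_continuous_onI)
    have int: "(LINT v|lborel. indicator {- real n..real n} v *\<^sub>R \<psi> (Complex v \<tau>))
        = P (Complex (real n) \<tau>) - P (Complex (- real n) \<tau>)" for n
    proof (rule integral_FTC_Icc[OF _ _ cont])
      fix v assume "- real n \<le> v" "v \<le> real n"
      have "((\<lambda>v. P (of_real v + \<i> * of_real \<tau>)) has_vector_derivative 1 * \<psi> (Complex v \<tau>)) (at v within {- real n..real n})"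
        by (rule field_vector_diff_chain_within[where g = P, unfolded o_def])
           (auto intro!: derivative_eq_intros has_field_derivative_at_within P' simp: has_vector_derivative_def
             inS[unfolded Complex_eq] Complex_eq scaleR_conv_of_real)
      then show "((\<lambda>v. P (Complex v \<tau>)) has_vector_derivative \<psi> (Complex v \<tau>)) (at v within {- real n..real n})"
        by (simp add: Complex_eq)
    qed auto
    have "(\<lambda>n. LINT v|lborel. indicator {- real n..real n} v *\<^sub>R \<psi> (Complex v \<tau>)) \<longlonglongrightarrow> (LINT v|lborel. \<psi> (Complex v \<tau>))"
    proof (rule integral_dominated_convergence[where w = "\<lambda>v. C * exp (- \<bar>v\<bar>)"])
      show "AE v in lborel. (\<lambda>n. indicator {- real n..real n} v *\<^sub>R \<psi> (Complex v \<tau>)) \<longlonglongrightarrow> \<psi> (Complex v \<tau>)"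
      proof (rule AE_I2, rule tendsto_eventually)
        fix v :: real
        show "\<forall>\<^sub>F n in sequentially. indicator {- real n..real n} v *\<^sub>R \<psi> (Complex v \<tau>) = \<psi> (Complex v \<tau>)"
          using eventually_ge_at_top[of "nat \<lceil>\<bar>v\<bar>\<rceil>"]
        proof eventually_elim
          case (elim n)
          then have "\<bar>v\<bar> \<le> real n" by linarith
          then show ?case by (auto simp: indicator_def)
        qed
      qed
      show "AE v in lborel. norm (indicator {- real n..real n} v *\<^sub>R \<psi> (Complex v \<tau>)) \<le> C * exp (- \<bar>v\<bar>)" for n
        using bound[of "Complex _ \<tau>"] tau order_trans[OF norm_ge_zero bound[of "Complex _ \<tau>"]]
        by (intro AE_I2) (auto simp: indicator_def)
    qed (use integrable_exp_minus_abs in auto)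
    then show ?thesis unfolding int .
  qed
  \<comment> \<open>\<open>X n\<close> stands for n or -n, which covers both vertical sides.\<close>
  have side: "(\<lambda>n. P (Complex (X n) \<theta>) - P (Complex (X n) 0)) \<longlonglongrightarrow> 0"
    if X: "\<And>n. \<bar>X n\<bar> = real n" for X :: "nat \<Rightarrow> real"
  proof (rule Lim_null_comparison)
    have "norm (P (Complex x \<theta>) - P (Complex x 0)) \<le> (C * exp (- \<bar>x\<bar>)) * norm (Complex x \<theta> - Complex x 0)" for x
    proof (rule field_differentiable_bound[where S = "{u. Re u = x \<and> \<bar>Im u\<bar> \<le> \<bar>\<theta>\<bar>}"])
      have "{u. Re u = x \<and> \<bar>Im u\<bar> \<le> \<bar>\<theta>\<bar>} = ({u. Re u \<le> x} \<inter> {u. Re u \<ge> x}) \<inter> ({u. Im u \<le> \<bar>\<theta>\<bar>} \<inter> {u. Im u \<ge> - \<bar>\<theta>\<bar>})"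
        by auto
      then show "convex {u. Re u = x \<and> \<bar>Im u\<bar> \<le> \<bar>\<theta>\<bar>}"
        by (auto intro!: convex_Int convex_halfspace_Im_le convex_halfspace_Im_ge convex_halfspace_Re_le convex_halfspace_Re_ge)
      show "(P has_field_derivative \<psi> z) (at z within {u. Re u = x \<and> \<bar>Im u\<bar> \<le> \<bar>\<theta>\<bar>})"
        if "z \<in> {u. Re u = x \<and> \<bar>Im u\<bar> \<le> \<bar>\<theta>\<bar>}" for z
        using that th by (intro has_field_derivative_at_within[OF P']) (auto simp: S_def)
    qed (use bound in auto)
    then show "\<forall>\<^sub>F n in sequentially. norm (P (Complex (X n) \<theta>) - P (Complex (X n) 0)) \<le> C * exp (- real n) * norm (Complex 0 \<theta>)"
      using X by (intro always_eventually allI) (metis complex_diff diff_zero diff_self)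
    show "(\<lambda>n. C * exp (- real n) * norm (Complex 0 \<theta>)) \<longlonglongrightarrow> 0" by real_asymp
  qed
  have "(\<lambda>n. (P (Complex (real n) \<theta>) - P (Complex (- real n) \<theta>)) - (P (Complex (real n) 0) - P (Complex (- real n) 0))) \<longlonglongrightarrow> 0"
    using tendsto_diff[OF side[of real] side[of "\<lambda>n. - real n"]] by (simp add: algebra_simps)
  moreover have "(\<lambda>n. (P (Complex (real n) \<theta>) - P (Complex (- real n) \<theta>)) - (P (Complex (real n) 0) - P (Complex (- real n) 0)))
     \<longlonglongrightarrow> (LINT v|lborel. \<psi> (Complex v \<theta>)) - (LINT v|lborel. \<psi> (Complex v 0))"
    by (intro tendsto_diff line) auto
  ultimately have "(LINT v|lborel. \<psi> (Complex v \<theta>)) - (LINT v|lborel. \<psi> (Complex v 0)) = 0"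
    using LIMSEQ_unique by blast
  then show ?thesis by (simp add: complex_of_real_def)
qed

section \<open>Euler's integral in the variable v = ln t\<close>

lemma exp_times_Gamma_integrand:
  fixes S :: complex
  shows
  "exp x *\<^sub>R (of_real (exp x) powr (S - 1) / of_real (exp (exp x))) = exp (S * of_real x - of_real (exp x))"
proof -
  have "of_real (exp x) powr (S - 1) = exp ((S - 1) * of_real x)"
    by (simp add: powr_def Ln_of_real)
  then show ?thesis
    by (simp add: scaleR_conv_of_real exp_diff exp_of_real[symmetric] left_diff_distrib)
qed

text \<open>The substitution t = e^v carries over absolute integrability and value together. The
  last steps descend from Lebesgue measure to \<open>lborel\<close>, whose completion it is.\<close>

lemma Gamma_log_integral_aux:
  assumes S: "Re S > 0"
  shows "integrable lborel (\<lambda>v. exp (S * of_real v - of_real (exp v)))"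
    and "(LINT v|lborel. exp (S * of_real v - of_real (exp v))) = Gamma S"
proof -
  define f where "f t = of_real t powr (S - 1) / of_real (exp t)" for t :: real
  have "f absolutely_integrable_on {0<..}"
    using absolutely_integrable_Gamma_integral[OF S, of 1] by (simp add: f_def[abs_def])
  moreover have "integral {0<..} f = Gamma S"
  proof -
    have "(f has_integral Gamma S) {0..}" unfolding f_def[abs_def] by (rule Gamma_integral_complex[OF S])
    then have "(f has_integral Gamma S) {0<..}"
      by (rule has_integral_spike_set_eq[THEN iffD1, rotated 2]) (auto intro: negligible_subset[of "{0}"])
    then show ?thesis by (rule integral_unique)
  qed
  moreover have "exp ` UNIV = {0 :: real<..}"
    by (auto simp: image_iff) (metis exp_ln)
  ultimately have "f absolutely_integrable_on (exp ` UNIV) \<and> integral (exp ` UNIV) f = Gamma S"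
    by simp
  moreover have "(\<lambda>x. \<bar>exp x\<bar> *\<^sub>R f (exp x)) absolutely_integrable_on UNIV \<and> integral UNIV (\<lambda>x. \<bar>exp x\<bar> *\<^sub>R f (exp x)) = Gamma S
      \<longleftrightarrow> f absolutely_integrable_on (exp ` UNIV) \<and> integral (exp ` UNIV) f = Gamma S"
    by (rule has_absolute_integral_change_of_variables_real) (auto intro!: derivative_eq_intros injI)
  ultimately have *: "(\<lambda>x. exp x *\<^sub>R f (exp x)) absolutely_integrable_on UNIV" "integral UNIV (\<lambda>x. exp x *\<^sub>R f (exp x)) = Gamma S"
    by auto
  let ?g = "\<lambda>v. exp (S * of_real v - of_real (exp v))"
  have eq: "(\<lambda>x. exp x *\<^sub>R f (exp x)) = ?g" unfolding f_def exp_times_Gamma_integrand ..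
  have meas: "?g \<in> borel_measurable lborel" by measurable
  have "integrable lebesgue ?g" using *(1) unfolding eq by (simp add: set_integrable_def)
  then show i: "integrable lborel ?g" using integrable_completion[OF meas] by simp
  have "(LINT v|lborel. ?g v) = (LINT v|lebesgue. ?g v)" by (rule integral_completion[OF meas, symmetric])
  also have "\<dots> = Gamma S"
    using set_lebesgue_integral_eq_integral(2)[OF *(1)] *(2) unfolding eq by (simp add: set_lebesgue_integral_def)
  finally show "(LINT v|lborel. ?g v) = Gamma S" .
qed

lemma Gamma_log_integral:
  assumes S: "Re S > 0" and c: "c > 0"
  shows "integrable lborel (\<lambda>v. exp (S * of_real v - of_real (c * exp v)))"
    and "(LINT v|lborel. exp (S * of_real v - of_real (c * exp v))) = Gamma S * of_real c powr (- S)"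
proof -
  let ?h = "\<lambda>v. exp (S * of_real v - of_real (exp v))"
  \<comment> \<open>Translating v by ln c multiplies e^v by c and e^(Sv) by c^S, which reduces
    everything to c = 1.\<close>
  have eq: "?h (ln c + 1 * v) = of_real c powr S * exp (S * of_real v - of_real (c * exp v))" for v
  proof -
    have "of_real c powr S = exp (S * of_real (ln c))" using c by (simp add: powr_def Ln_of_real)
    moreover have "exp (ln c + 1 * v) = c * exp v" using c by (simp add: exp_add)
    ultimately show ?thesis by (simp only:) (simp add: algebra_simps flip: exp_add)
  qed
  have nz: "of_real c powr S \<noteq> (0 :: complex)" using c by simp
  have "integrable lborel (\<lambda>v. of_real c powr S * exp (S * of_real v - of_real (c * exp v)))"
    using lborel_integrable_real_affine[OF Gamma_log_integral_aux(1)[OF S], of 1 "ln c"] unfolding eq by simp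
  then have "integrable lborel (\<lambda>v. inverse (of_real c powr S) * (of_real c powr S * exp (S * of_real v - of_real (c * exp v))))"
    by (rule integrable_mult_right)
  moreover have "inverse (of_real c powr S) * (of_real c powr S * x) = x" for x :: complex by (metis nz left_inverse mult.assoc mult_1_left)
  ultimately show "integrable lborel (\<lambda>v. exp (S * of_real v - of_real (c * exp v)))"
    by (simp only:)
  have "of_real c powr S * (LINT v|lborel. exp (S * of_real v - of_real (c * exp v))) = Gamma S"
    using lborel_integral_real_affine[of 1 ?h "ln c"] Gamma_log_integral_aux(2)[OF S] unfolding eq by simp
  then show "(LINT v|lborel. exp (S * of_real v - of_real (c * exp v))) = Gamma S * of_real c powr (- S)"
    using nz by (simp add: powr_minus field_simps)
qed

text \<open>The integrals over [-n, n] are holomorphic by differentiation under the integral sign,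
  and they converge locally uniformly. Decay faster than every exponential is what makes the limit
  entire rather than holomorphic in a strip only.\<close>

lemma holomorphic_exponential_integral:
  fixes g :: "real \<Rightarrow> complex"
  assumes cont: "continuous_on UNIV g"
    and decay: "\<And>L::nat. \<exists>C\<ge>0. \<forall>v. norm (g v) \<le> C * exp (- (real L * \<bar>v\<bar>))"
  shows "(\<lambda>s. LINT v|lborel. g v * exp (s * of_real v)) holomorphic_on UNIV"
proof (rule holomorphic_uniform_sequence[where f = "\<lambda>n s. integral (cbox (- real n) (real n)) (\<lambda>v. g v * exp (s * of_real v))"])
  have cont': "continuous_on A (\<lambda>v. g v * exp (s * of_real v))" for A s
    by (intro continuous_intros continuous_on_subset[OF cont]) auto
  show "(\<lambda>s. integral (cbox (- real n) (real n)) (\<lambda>v. g v * exp (s * of_real v))) holomorphic_on UNIV" for n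
  proof (rule leibniz_rule_holomorphic[where fx = "\<lambda>s v. g v * (exp (s * of_real v) * of_real v)"])
    show "((\<lambda>s. g v * exp (s * of_real v)) has_field_derivative g v * (exp (s * of_real v) * of_real v)) (at s within UNIV)" for s v
      by (auto intro!: derivative_eq_intros)
    show "(\<lambda>v. g v * exp (s * of_real v)) integrable_on cbox (- real n) (real n)" for s
      by (rule integrable_continuous[OF cont'])
    show "continuous_on (UNIV \<times> cbox (- real n) (real n)) (\<lambda>(s, v). g v * (exp (s * of_real v) * of_real v))"
      unfolding case_prod_beta by (intro continuous_intros continuous_on_compose2[OF cont]) auto
  qed auto
  fix s0 :: complex
  \<comment> \<open>Two more than |s0|: one unit pays for the radius of the disc around s0, the
    other leaves the integrable weight e^(-|v|).\<close>
  define L where "L = nat \<lceil>norm s0 + 2\<rceil>"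
  have L: "real L \<ge> norm s0 + 2" unfolding L_def by linarith
  obtain C where C: "C \<ge> 0" "\<And>v. norm (g v) \<le> C * exp (- (real L * \<bar>v\<bar>))" using decay[of L] by blast
  define w where "w v = C * exp (- \<bar>v\<bar>)" for v :: real
  have w: "integrable lborel w" using integrable_exp_minus_abs by (simp add: w_def[abs_def])
  have bound: "norm (g v * exp (s * of_real v)) \<le> w v" if "s \<in> cball s0 1" for s v
  proof -
    have "norm s \<le> norm s0 + 1" using that norm_triangle_sub[of s s0] by (simp add: dist_norm norm_minus_commute)
    moreover have "\<bar>Re s\<bar> \<le> norm s" by (rule abs_Re_le_cmod)
    ultimately have "\<bar>Re s\<bar> \<le> real L - 1" using L by linarith
    then have "\<bar>Re s\<bar> * \<bar>v\<bar> \<le> (real L - 1) * \<bar>v\<bar>" by (intro mult_right_mono) auto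
    moreover have "Re s * v \<le> \<bar>Re s\<bar> * \<bar>v\<bar>" by (simp flip: abs_mult)
    ultimately have "norm (exp (s * of_real v)) \<le> exp ((real L - 1) * \<bar>v\<bar>)" by simp
    from mult_mono[OF C(2) this] have "norm (g v * exp (s * of_real v)) \<le> C * exp (- (real L * \<bar>v\<bar>)) * exp ((real L - 1) * \<bar>v\<bar>)"
      using C(1) by (simp add: norm_mult)
    also have "\<dots> = w v" by (simp add: w_def algebra_simps flip: exp_add)
    finally show ?thesis .
  qed
  have meas: "(\<lambda>v. g v * exp (s * of_real v)) \<in> borel_measurable lborel" for s
    using borel_measurable_continuous_onI[OF cont'] by simp
  have int: "integrable lborel (\<lambda>v. g v * exp (s * of_real v))" if "s \<in> cball s0 1" for s
    by (rule Bochner_Integration.integrable_bound[OF w meas]) (use bound[OF that] C(1) in \<open>auto simp: w_def\<close>)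
  \<comment> \<open>The truncation error is bounded by \<open>tail n\<close> for all s in the disc
    at once, as uniform convergence demands.\<close>
  define tail where "tail n = (LINT v|lborel. w v - indicator {- real n..real n} v * w v)" for n
  have ind_int: "integrable lborel (\<lambda>v. indicator {- real n..real n} v * w v)" for n
    by (rule Bochner_Integration.integrable_bound[OF w]) (use w in \<open>auto simp: indicator_def\<close>)
  have tail: "tail \<longlonglongrightarrow> 0"
  proof -
    have "tail \<longlonglongrightarrow> (LINT v|(lborel :: real measure). 0)"
      unfolding tail_def
    proof (rule integral_dominated_convergence[where w = w and f = "\<lambda>_. 0" and s = "\<lambda>n v. w v - indicator {- real n..real n} v * w v"])
      show "AE v in lborel. (\<lambda>n. w v - indicator {- real n..real n} v * w v) \<longlonglongrightarrow> 0"
      proof (rule AE_I2, rule tendsto_eventually)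
        fix v :: real
        show "\<forall>\<^sub>F n in sequentially. w v - indicator {- real n..real n} v * w v = 0"
          using eventually_ge_at_top[of "nat \<lceil>\<bar>v\<bar>\<rceil>"]
        proof eventually_elim
          case (elim n)
          then have "\<bar>v\<bar> \<le> real n" by linarith
          then show ?case by (auto simp: indicator_def)
        qed
      qed
      show "AE v in lborel. norm (w v - indicator {- real n..real n} v * w v) \<le> w v" for n
        using C(1) by (auto simp: indicator_def w_def)
    qed (use w ind_int in auto)
    then show ?thesis by simp
  qed
  have diff: "norm (integral (cbox (- real n) (real n)) (\<lambda>v. g v * exp (s * of_real v)) - (LINT v|lborel. g v * exp (s * of_real v))) \<le> tail n"
    if s: "s \<in> cball s0 1" for n s
  proof -
    let ?F = "\<lambda>v. g v * exp (s * of_real v)"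
    have si: "integrable lborel (\<lambda>v. indicator {- real n..real n} v *\<^sub>R ?F v)"
      by (rule Bochner_Integration.integrable_bound[OF int[OF s]]) (use meas in \<open>auto simp: indicator_def\<close>)
    have "integral (cbox (- real n) (real n)) ?F = (LINT v|lborel. indicator {- real n..real n} v *\<^sub>R ?F v)"
      using set_borel_integral_eq_integral(2)[of "{- real n..real n}" ?F] si
      by (simp add: set_integrable_def set_lebesgue_integral_def)
    then have "norm (integral (cbox (- real n) (real n)) ?F - (LINT v|lborel. ?F v))
      = norm (LINT v|lborel. ?F v - indicator {- real n..real n} v *\<^sub>R ?F v)"
      using int[OF s] si by (simp add: norm_minus_commute)
    also have "\<dots> \<le> (LINT v|lborel. norm (?F v - indicator {- real n..real n} v *\<^sub>R ?F v))" by (rule integral_norm_bound)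
    also have "\<dots> \<le> tail n"
      unfolding tail_def
    proof (rule integral_mono)
      show "norm (?F v - indicator {- real n..real n} v *\<^sub>R ?F v) \<le> w v - indicator {- real n..real n} v * w v" for v
        using bound[OF s, of v] by (auto simp: indicator_def)
    qed (use int[OF s] si w ind_int in auto)
    finally show ?thesis .
  qed
  show "\<exists>d>0. cball s0 d \<subseteq> UNIV \<and> uniform_limit (cball s0 d) (\<lambda>n s. integral (cbox (- real n) (real n)) (\<lambda>v. g v * exp (s * of_real v)))
     (\<lambda>s. LINT v|lborel. g v * exp (s * of_real v)) sequentially"
  proof (intro exI[of _ 1] conjI uniform_limitI)
    fix e :: real assume "e > 0"
    then have "\<forall>\<^sub>F n in sequentially. tail n < e" by (rule order_tendstoD(2)[OF tail])
    then show "\<forall>\<^sub>F n in sequentially. \<forall>s\<in>cball s0 1. dist (integral (cbox (- real n) (real n)) (\<lambda>v. g v * exp (s * of_real v)))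
        (LINT v|lborel. g v * exp (s * of_real v)) < e"
    proof eventually_elim
      case (elim n)
      then show ?case unfolding dist_norm using diff[of _ n] by (blast intro: le_less_trans)
    qed
  qed auto
qed auto

section \<open>Real zeros of the Fourier transform of a function on a strip\<close>

lemma integrable_exp_minus_mult_abs:
  assumes "\<delta> > 0"
  shows "integrable lborel (\<lambda>x::real. exp (- (\<delta> * \<bar>x\<bar>)))"
  using lborel_integrable_real_affine[OF integrable_exp_minus_abs, of \<delta> 0] assms
  by (simp add: abs_mult)

text \<open>Isolates what the analytic half of the argument uses of \<Phi>. The decay constant may
  blow up as \<theta> approaches pi/2; behaviour at the edge enters only through the hypotheses of
  \<open>transform_zeros_unbounded\<close>.\<close>

locale strip_function =
  fixes F :: "complex \<Rightarrow> complex"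
  assumes holo: "F holomorphic_on {u. \<bar>Im u\<bar> < pi / 2}"
    and decay: "\<And>\<theta>. 0 \<le> \<theta> \<Longrightarrow> \<theta> < pi / 2 \<Longrightarrow> \<exists>C. \<forall>u. \<bar>Im u\<bar> \<le> \<theta> \<longrightarrow> norm (F u) \<le> C * exp (- \<bar>Re u\<bar>)"
begin

section \<open>The transform h of the overview, and its inversion inside the strip\<close>

definition transform :: "real \<Rightarrow> complex" where
  "transform t = (LINT v|lborel. F (of_real v) * cis (t * v))"

lemma continuous_on_line:
  assumes "\<bar>\<theta>\<bar> < pi / 2"
  shows "continuous_on A (\<lambda>v. F (Complex v \<theta>))"
  unfolding Complex_eq
  by (rule continuous_on_compose2[OF holomorphic_on_imp_continuous_on[OF holo]])
     (use assms in \<open>auto intro!: continuous_intros\<close>)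

lemma bound_line:
  assumes "\<bar>\<theta>\<bar> < pi / 2"
  obtains C where "\<And>v. norm (F (Complex v \<theta>)) \<le> C * exp (- \<bar>v\<bar>)"
  using decay[of "\<bar>\<theta>\<bar>"] assms by (metis abs_ge_zero complex.sel order_refl)

lemma integrable_line:
  assumes "\<bar>\<theta>\<bar> < pi / 2"
  shows "integrable lborel (\<lambda>v. F (Complex v \<theta>))"
proof -
  obtain C where C: "\<And>v. norm (F (Complex v \<theta>)) \<le> C * exp (- \<bar>v\<bar>)" using bound_line[OF assms] by blast
  show ?thesis
  proof (rule Bochner_Integration.integrable_bound)
    show "integrable lborel (\<lambda>v. C * exp (- \<bar>v\<bar>))" using integrable_exp_minus_abs by simp
    show "AE v in lborel. norm (F (Complex v \<theta>)) \<le> norm (C * exp (- \<bar>v\<bar>))"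
      using C by (intro AE_I2) (metis order_trans abs_ge_self real_norm_def)
  qed (use continuous_on_line[OF assms, of UNIV] borel_measurable_continuous_onI in auto)
qed

text \<open>The integral of F(u) e^(itu) is the same on all horizontal lines, and at height \<theta>
  the kernel carries the extra factor e^(-t \<theta>).\<close>

lemma transform_shift:
  assumes "\<bar>\<theta>\<bar> < pi / 2"
  shows "(LINT v|lborel. F (Complex v \<theta>) * cis (t * v)) = of_real (exp (t * \<theta>)) * transform t"
proof -
  define \<psi> where "\<psi> u = F u * exp (\<i> * of_real t * u)" for u
  obtain C where C: "\<And>u. \<bar>Im u\<bar> \<le> \<bar>\<theta>\<bar> \<Longrightarrow> norm (F u) \<le> C * exp (- \<bar>Re u\<bar>)"
    using decay[of "\<bar>\<theta>\<bar>"] assms by auto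
  have "(LINT v|lborel. \<psi> (Complex v \<theta>)) = (LINT v|lborel. \<psi> (of_real v))"
  proof (rule contour_shift)
    show "\<psi> holomorphic_on {u. \<bar>Im u\<bar> < pi / 2}"
      unfolding \<psi>_def by (intro holomorphic_intros holo)
    fix u assume u: "\<bar>Im u\<bar> \<le> \<bar>\<theta>\<bar>"
    have "- (t * Im u) \<le> \<bar>t\<bar> * \<bar>\<theta>\<bar>"
      using mult_left_mono[OF u, of "\<bar>t\<bar>"] by (simp flip: abs_mult)
    then have "norm (exp (\<i> * of_real t * u)) \<le> exp (\<bar>t\<bar> * \<bar>\<theta>\<bar>)" by simp
    from mult_mono[OF C[OF u] this] show "norm (\<psi> u) \<le> (C * exp (\<bar>t\<bar> * \<bar>\<theta>\<bar>)) * exp (- \<bar>Re u\<bar>)"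
      using order_trans[OF norm_ge_zero C[OF u]] unfolding \<psi>_def by (simp add: norm_mult mult_ac)
  qed (use assms in auto)
  moreover have "\<psi> (of_real v) = F (of_real v) * cis (t * v)" for v
    unfolding \<psi>_def by (simp add: cis_conv_exp mult_ac)
  moreover have "\<psi> (Complex v \<theta>) = F (Complex v \<theta>) * cis (t * v) * of_real (exp (- (t * \<theta>)))" for v
  proof -
    have "exp (\<i> * of_real t * Complex v \<theta>) = exp (\<i> * of_real (t * v)) * exp (of_real (- (t * \<theta>)))"
      by (simp only: exp_add[symmetric]) (simp add: Complex_eq algebra_simps)
    then show ?thesis unfolding \<psi>_def cis_conv_exp exp_of_real by simp
  qed
  ultimately have "(LINT v|lborel. F (Complex v \<theta>) * cis (t * v)) * of_real (exp (- (t * \<theta>))) = transform t"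
    unfolding transform_def by simp
  then have "of_real (exp (- (t * \<theta>)) * exp (t * \<theta>)) * (LINT v|lborel. F (Complex v \<theta>) * cis (t * v)) = of_real (exp (t * \<theta>)) * transform t"
    by (simp only: of_real_mult mult_ac)
  moreover have "exp (- (t * \<theta>)) * exp (t * \<theta>) = 1" by (simp flip: exp_add)
  ultimately show ?thesis by (simp only: of_real_1 mult_1_left)
qed

text \<open>The line is moved up for t \<ge> 0 and down for t < 0, so that the shift produces decay
  in both directions. Every rate below pi/2 is reached, but not pi/2 itself: closing that gap on the
  side t > 0 is the purpose of \<open>integrable_up_to_boundary\<close>.\<close>

lemma transform_decay:
  assumes "0 \<le> \<theta>" "\<theta> < pi / 2"
  obtains B where "B \<ge> 0" "\<And>t. norm (transform t) \<le> B * exp (- (\<theta> * \<bar>t\<bar>))"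
proof
  define B where "B = (LINT v|lborel. norm (F (Complex v \<theta>))) + (LINT v|lborel. norm (F (Complex v (- \<theta>))))"
  show B0: "B \<ge> 0" unfolding B_def by (intro add_nonneg_nonneg integral_nonneg) auto
  fix t
  have *: "exp (t * \<tau>) * norm (transform t) \<le> (LINT v|lborel. norm (F (Complex v \<tau>)))" if "\<bar>\<tau>\<bar> < pi / 2" for \<tau>
  proof -
    have "exp (t * \<tau>) * norm (transform t) = norm (LINT v|lborel. F (Complex v \<tau>) * cis (t * v))"
      unfolding transform_shift[OF that] by (simp add: norm_mult)
    also have "\<dots> \<le> (LINT v|lborel. norm (F (Complex v \<tau>) * cis (t * v)))" by (rule integral_norm_bound)
    finally show ?thesis by (simp add: norm_mult)
  qed
  have "exp (\<theta> * \<bar>t\<bar>) * norm (transform t) \<le> B"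
  proof (cases "t \<ge> 0")
    case True
    then have "exp (\<theta> * \<bar>t\<bar>) * norm (transform t) \<le> (LINT v|lborel. norm (F (Complex v \<theta>)))"
      using *[of \<theta>] assms by (simp add: mult.commute)
    also have "\<dots> \<le> B" unfolding B_def by (simp add: integral_nonneg)
    finally show ?thesis .
  next
    case False
    then have "exp (\<theta> * \<bar>t\<bar>) * norm (transform t) \<le> (LINT v|lborel. norm (F (Complex v (- \<theta>))))"
      using *[of "- \<theta>"] assms by (simp add: mult.commute)
    also have "\<dots> \<le> B" unfolding B_def by (simp add: integral_nonneg)
    finally show ?thesis .
  qed
  then show "norm (transform t) \<le> B * exp (- (\<theta> * \<bar>t\<bar>))" by (simp add: exp_minus field_simps)
qed

lemma continuous_transform: "continuous_on UNIV transform"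
  unfolding transform_def
proof (rule continuous_on_integral_dominated)
  have i: "integrable lborel (\<lambda>v. F (of_real v))"
    using integrable_line[of 0] by (simp add: complex_of_real_def)
  show "integrable lborel (\<lambda>v. norm (F (of_real v)))" using i by simp
  show "(\<lambda>v. F (of_real v) * cis (t * v)) \<in> borel_measurable lborel" for t
    using integrable_mult_cis[OF i] by (rule borel_measurable_integrable)
qed (auto intro!: continuous_intros simp: norm_mult)

lemma norm_exp_kernel: "norm (exp (- (\<i> * of_real t * u))) = exp (t * Im u)"
  by simp

lemma imaginary_kernel: "exp (- (\<i> * of_real t * Complex 0 \<theta>)) = of_real (exp (t * \<theta>))"
proof -
  have "- (\<i> * of_real t * Complex 0 \<theta>) = of_real (t * \<theta>)" by (simp add: complex_eq_iff)
  then show ?thesis by (simp only: exp_of_real)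
qed

lemma measurable_kernel: "(\<lambda>t. transform t * exp (- (\<i> * of_real t * u))) \<in> borel_measurable lborel"
  using borel_measurable_continuous_onI[OF continuous_transform] by measurable

lemma integrable_inversion:
  assumes "\<bar>Im u\<bar> < pi / 2"
  shows "integrable lborel (\<lambda>t. transform t * exp (- (\<i> * of_real t * u)))"
proof -
  \<comment> \<open>Halfway between |Im u| and the edge, so the decay rate of the transform exceeds
    the growth rate of the kernel.\<close>
  define \<theta> where "\<theta> = (\<bar>Im u\<bar> + pi / 2) / 2"
  have th: "0 \<le> \<theta>" "\<theta> < pi / 2" "\<theta> > \<bar>Im u\<bar>" using assms by (auto simp: \<theta>_def)
  obtain B where B: "B \<ge> 0" "\<And>t. norm (transform t) \<le> B * exp (- (\<theta> * \<bar>t\<bar>))" using transform_decay[OF th(1,2)] by blast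
  show ?thesis
  proof (rule Bochner_Integration.integrable_bound)
    show "integrable lborel (\<lambda>t. B * exp (- ((\<theta> - \<bar>Im u\<bar>) * \<bar>t\<bar>)))"
      using integrable_exp_minus_mult_abs[of "\<theta> - \<bar>Im u\<bar>"] th by simp
    show "AE t in lborel. norm (transform t * exp (- (\<i> * of_real t * u))) \<le> norm (B * exp (- ((\<theta> - \<bar>Im u\<bar>) * \<bar>t\<bar>)))"
    proof (rule AE_I2)
      fix t
      have "norm (transform t * exp (- (\<i> * of_real t * u))) = norm (transform t) * exp (t * Im u)"
        by (simp add: norm_mult)
      also have "\<dots> \<le> (B * exp (- (\<theta> * \<bar>t\<bar>))) * exp (\<bar>t\<bar> * \<bar>Im u\<bar>)"
        using B by (intro mult_mono) (auto simp flip: abs_mult)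
      also have "\<dots> = B * exp (- ((\<theta> - \<bar>Im u\<bar>) * \<bar>t\<bar>))"
        by (simp flip: exp_add add: algebra_simps)
      finally show "norm (transform t * exp (- (\<i> * of_real t * u))) \<le> norm (B * exp (- ((\<theta> - \<bar>Im u\<bar>) * \<bar>t\<bar>)))"
        using B(1) by simp
    qed
  qed (use measurable_kernel in simp)
qed

text \<open>This is \<open>fourier_inversion_at_0\<close> on the horizontal line through u,
  recentred at Re u. The height contributes e^(t Im u) and the recentring e^(-it Re u); together
  they form the kernel e^(-itu).\<close>

lemma transform_inversion:
  assumes "\<bar>Im u\<bar> < pi / 2"
  shows "(LINT t|lborel. transform t * exp (- (\<i> * of_real t * u))) = 2 * pi * F u"
proof -
  define G where "G x = F (Complex (Re u + x) (Im u))" for x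
  have eq: "(LINT v|lborel. G v * cis (t * v)) = transform t * exp (- (\<i> * of_real t * u))" for t
  proof -
    have "transform t * exp (- (\<i> * of_real t * u)) = of_real (exp (t * Im u)) * transform t * cis (- (t * Re u))"
    proof -
      have "- (\<i> * of_real t * u) = of_real (t * Im u) + \<i> * of_real (- (t * Re u))"
        by (simp add: complex_eq_iff)
      then have "exp (- (\<i> * of_real t * u)) = of_real (exp (t * Im u)) * cis (- (t * Re u))"
        by (simp only: exp_add exp_of_real cis_conv_exp)
      then show ?thesis by (simp only: mult_ac)
    qed
    also have "\<dots> = (LINT v|lborel. F (Complex v (Im u)) * cis (t * v) * cis (- (t * Re u)))"
      using transform_shift[OF assms, of t] by simp
    also have "\<dots> = (LINT v|lborel. F (Complex v (Im u)) * cis (t * (v - Re u)))"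
    proof -
      have "cis (t * v) * cis (- (t * Re u)) = cis (t * (v - Re u))" for v
        by (simp add: cis_mult algebra_simps)
      then show ?thesis by (simp only: mult.assoc)
    qed
    also have "\<dots> = (LINT v|lborel. G v * cis (t * v))"
      using lborel_integral_real_affine[of 1 "\<lambda>v. F (Complex v (Im u)) * cis (t * (v - Re u))" "Re u"]
      by (simp add: G_def)
    finally show ?thesis by simp
  qed
  obtain C where C: "\<And>v. norm (F (Complex v (Im u))) \<le> C * exp (- \<bar>v\<bar>)" using bound_line[OF assms] by blast
  have C0: "C \<ge> 0" using order_trans[OF norm_ge_zero C[of 0]] by simp
  have "(LINT t|lborel. (LINT v|lborel. G v * cis (t * v))) = 2 * pi * G 0"
  proof (rule fourier_inversion_at_0)
    show "continuous_on UNIV G"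
      unfolding G_def by (rule continuous_on_compose2[OF continuous_on_line[OF assms, of UNIV]]) (auto intro!: continuous_intros)
    show "norm (G x) \<le> C" for x
      unfolding G_def by (rule order_trans[OF C]) (use C0 in \<open>simp add: mult_left_le\<close>)
    show "integrable lborel G"
      using lborel_integrable_real_affine[OF integrable_line[OF assms], of 1 "Re u"] by (simp add: G_def[abs_def])
    show "integrable lborel (\<lambda>t. LINT v|lborel. G v * cis (t * v))"
      unfolding eq by (rule integrable_inversion[OF assms])
  qed
  then show ?thesis unfolding eq by (simp add: G_def)
qed

text \<open>Beyond T there is no cancellation, so the integral of |h(t)| e^(t \<theta>) over t \<ge>
  T is, up to sign, 2 pi F(i\<theta>) minus the part t < T. Both are bounded uniformly in \<theta>,
  and monotone convergence reaches pi/2. The weight 1 + e^(t pi/2) is chosen because it dominates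
  e^(ty) for all real t and all y between 0 and pi/2.\<close>

lemma integrable_up_to_boundary:
  assumes real: "\<And>t. transform t \<in> \<real>"
    and T: "T \<ge> 0" "\<And>t. t \<ge> T \<Longrightarrow> transform t \<noteq> 0"
    and bdd: "\<And>\<theta>. 0 \<le> \<theta> \<Longrightarrow> \<theta> < pi / 2 \<Longrightarrow> norm (F (Complex 0 \<theta>)) \<le> B"
  shows "integrable lborel (\<lambda>t. norm (transform t) * (1 + exp (t * (pi / 2))))"
proof -
  define h where "h t = Re (transform t)" for t
  have h: "transform t = of_real (h t)" for t unfolding h_def using real[of t] by simp
  have conth: "continuous_on A h" for A
    unfolding h_def by (intro continuous_intros continuous_on_subset[OF continuous_transform]) auto
  have hm [measurable]: "h \<in> borel_measurable borel" using conth by (rule borel_measurable_continuous_onI)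
  \<comment> \<open>\<open>s\<close> is the constant sign of \<open>h\<close> on the half-line,
    obtained from connectedness.\<close>
  obtain s :: real where s: "\<bar>s\<bar> = 1" "\<And>t. t \<ge> T \<Longrightarrow> \<bar>h t\<bar> = s * h t"
  proof -
    have nz: "h t \<noteq> 0" if "t \<ge> T" for t using T(2)[OF that] h by simp
    have "(\<forall>t\<ge>T. h t > 0) \<or> (\<forall>t\<ge>T. h t < 0)"
    proof (rule ccontr)
      assume "\<not> ?thesis"
      then obtain a b where ab: "a \<ge> T" "b \<ge> T" "h a \<le> 0" "h b \<ge> 0" by (meson not_le less_imp_le)
      have "connected (h ` {T..})" by (intro connected_continuous_image conth convex_connected) auto
      from connectedD_interval[OF this, of "h a" "h b" 0] have "0 \<in> h ` {T..}" using ab by auto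
      then show False using nz by auto
    qed
    then show thesis
    proof
      assume "\<forall>t\<ge>T. h t > 0" then show thesis by (intro that[of 1]) auto
    next
      assume "\<forall>t\<ge>T. h t < 0" then show thesis by (intro that[of "-1"]) auto
    qed
  qed
  \<comment> \<open>Increases from 0 to pi/2 without reaching it: inversion is available at every
    \<open>th n\<close>, and the integrands \<open>I n\<close> increase with n.\<close>
  define th where "th n = pi / 2 * (1 - 1 / real (Suc n))" for n
  have th: "0 \<le> th n" "th n < pi / 2" for n by (auto simp: th_def field_simps)
  have th_mono: "mono th" unfolding th_def by (intro monoI mult_left_mono) (auto simp: frac_le)
  have th_lim: "th \<longlonglongrightarrow> pi / 2" unfolding th_def by real_asymp
  have intall: "integrable lborel (\<lambda>t. h t * exp (t * \<theta>))" if "0 \<le> \<theta>" "\<theta> < pi / 2" for \<theta>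
  proof -
    have "integrable lborel (\<lambda>t. Re (transform t * exp (- (\<i> * of_real t * Complex 0 \<theta>))))"
      by (intro integrable_Re integrable_inversion) (use that in auto)
    then show ?thesis unfolding imaginary_kernel by (simp add: h)
  qed
  have h0: "integrable lborel h" using intall[of 0] by simp
  define I where "I n t = indicator {T..} t * (\<bar>h t\<bar> * exp (t * th n))" for n t
  have I_int: "integrable lborel (I n)" for n
    unfolding I_def
  proof (rule Bochner_Integration.integrable_bound[OF intall[OF th[of n]]])
    show "AE t in lborel. norm (indicator {T..} t * (\<bar>h t\<bar> * exp (t * th n))) \<le> norm (h t * exp (t * th n))"
      by (auto simp: indicator_def abs_mult)
  qed measurable
  \<comment> \<open>The first summand bounds the full integral through inversion; the second bounds
    the part t < T, where t \<theta> \<le> T pi/2 because T is nonnegative.\<close>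
  define M where "M = 2 * pi * B + exp (T * (pi / 2)) * (LINT t|lborel. \<bar>h t\<bar>)"
  have I_bd: "integral\<^sup>L lborel (I n) \<le> M" for n
  proof -
    define J where "J t = indicator {..<T} t * (h t * exp (t * th n))" for t
    have J_int: "integrable lborel J"
      unfolding J_def
    proof (rule Bochner_Integration.integrable_bound[OF intall[OF th[of n]]])
      show "AE t in lborel. norm (indicator {..<T} t * (h t * exp (t * th n))) \<le> norm (h t * exp (t * th n))"
        by (auto simp: indicator_def abs_mult)
    qed measurable
    have sI: "s * I n t = h t * exp (t * th n) - J t" for t
    proof (cases "t \<ge> T")
      case True
      have "s * \<bar>h t\<bar> = h t" using s(1) s(2)[OF True] by (metis abs_mult_self_eq mult.assoc mult_1)
      then show ?thesis using True unfolding I_def J_def by (simp flip: mult.assoc)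
    qed (simp add: I_def J_def)
    have "s * integral\<^sup>L lborel (I n) = (LINT t|lborel. s * I n t)" by simp
    also have "\<dots> = (LINT t|lborel. h t * exp (t * th n) - J t)" by (simp only: sI)
    also have "\<dots> = (LINT t|lborel. h t * exp (t * th n)) - integral\<^sup>L lborel J"
      using intall[OF th] J_int by simp
    finally have eq: "s * integral\<^sup>L lborel (I n) = (LINT t|lborel. h t * exp (t * th n)) - integral\<^sup>L lborel J" .
    have "of_real (LINT t|lborel. h t * exp (t * th n)) = 2 * pi * F (Complex 0 (th n))"
      using transform_inversion[of "Complex 0 (th n)"] th[of n]
      unfolding imaginary_kernel h of_real_mult[symmetric] integral_complex_of_real by simp
    from arg_cong[OF this, of norm]
    have "\<bar>LINT t|lborel. h t * exp (t * th n)\<bar> = 2 * pi * norm (F (Complex 0 (th n)))"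
      by (simp add: norm_mult)
    then have 1: "\<bar>LINT t|lborel. h t * exp (t * th n)\<bar> \<le> 2 * pi * B" using bdd[OF th[of n]] by simp
    have "\<bar>integral\<^sup>L lborel J\<bar> \<le> (LINT t|lborel. \<bar>J t\<bar>)" by (rule integral_abs_bound)
    also have "\<dots> \<le> (LINT t|lborel. exp (T * (pi / 2)) * \<bar>h t\<bar>)"
    proof (rule integral_mono)
      show "\<bar>J t\<bar> \<le> exp (T * (pi / 2)) * \<bar>h t\<bar>" for t
      proof (cases "t < T")
        case True
        have "t * th n \<le> T * (pi / 2)"
          using True T(1) th[of n] by (intro order_trans[OF mult_right_mono[of t T]] mult_left_mono) auto
        then have "\<bar>h t\<bar> * exp (t * th n) \<le> \<bar>h t\<bar> * exp (T * (pi / 2))" by (intro mult_left_mono) auto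
        then show ?thesis using True by (simp add: J_def abs_mult mult.commute)
      qed (simp add: J_def)
    qed (use J_int h0 in auto)
    finally have 2: "\<bar>integral\<^sup>L lborel J\<bar> \<le> exp (T * (pi / 2)) * (LINT t|lborel. \<bar>h t\<bar>)" by simp
    have "integral\<^sup>L lborel (I n) \<le> \<bar>s * integral\<^sup>L lborel (I n)\<bar>" using s(1) by (simp add: abs_mult)
    then show ?thesis using 1 2 unfolding eq M_def by linarith
  qed
  have I_mono: "I m t \<le> I n t" if "m \<le> n" for m n t
    using monoD[OF th_mono that] T(1) unfolding I_def by (auto simp: indicator_def intro!: mult_left_mono)
  have "incseq (\<lambda>n. integral\<^sup>L lborel (I n))" using I_int I_mono by (intro incseq_SucI integral_mono) auto
  then obtain L where L: "(\<lambda>n. integral\<^sup>L lborel (I n)) \<longlonglongrightarrow> L"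
    using incseq_convergent[of "\<lambda>n. integral\<^sup>L lborel (I n)" M] I_bd by blast
  have lim: "integrable lborel (\<lambda>t. indicator {T..} t * (\<bar>h t\<bar> * exp (t * (pi / 2))))"
  proof (rule integral_monotone_convergence_nonneg(1)[OF I_int _ _ _ L])
    show "AE t in lborel. mono (\<lambda>n. I n t)" by (auto intro!: monoI I_mono)
    show "AE t in lborel. 0 \<le> I n t" for n by (auto simp: I_def)
    show "AE t in lborel. (\<lambda>n. I n t) \<longlonglongrightarrow> indicator {T..} t * (\<bar>h t\<bar> * exp (t * (pi / 2)))"
      unfolding I_def by (intro AE_I2 tendsto_intros th_lim)
  qed measurable
  show ?thesis
  proof (rule Bochner_Integration.integrable_bound)
    show "integrable lborel (\<lambda>t. (1 + exp (T * (pi / 2))) * \<bar>h t\<bar> + indicator {T..} t * (\<bar>h t\<bar> * exp (t * (pi / 2))))"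
      using lim h0 by simp
    show "AE t in lborel. norm (norm (transform t) * (1 + exp (t * (pi / 2)))) \<le>
        norm ((1 + exp (T * (pi / 2))) * \<bar>h t\<bar> + indicator {T..} t * (\<bar>h t\<bar> * exp (t * (pi / 2))))"
    proof (rule AE_I2)
      fix t
      have "\<bar>h t\<bar> * (1 + exp (t * (pi / 2))) \<le> (1 + exp (T * (pi / 2))) * \<bar>h t\<bar> + indicator {T..} t * (\<bar>h t\<bar> * exp (t * (pi / 2)))"
      proof (cases "t \<ge> T")
        case True then show ?thesis by (simp add: algebra_simps)
      next
        case False
        then have "\<bar>h t\<bar> * (1 + exp (t * (pi / 2))) \<le> \<bar>h t\<bar> * (1 + exp (T * (pi / 2)))" by (intro mult_left_mono) auto
        with False show ?thesis by (simp add: mult.commute)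
      qed
      then show "norm (norm (transform t) * (1 + exp (t * (pi / 2)))) \<le>
        norm ((1 + exp (T * (pi / 2))) * \<bar>h t\<bar> + indicator {T..} t * (\<bar>h t\<bar> * exp (t * (pi / 2))))"
        by (simp add: h abs_mult)
    qed
  qed (simp add: h)
qed

text \<open>\<open>D\<close> has two uses: the point 0 supplies the bound for F on the imaginary
  segment that \<open>integrable_up_to_boundary\<close> asks for, and density forces the boundary
  values, once known to be continuous, to vanish everywhere.\<close>

theorem transform_zeros_unbounded:
  assumes real: "\<And>t. transform t \<in> \<real>"
    and nz: "\<exists>u. \<bar>Im u\<bar> < pi / 2 \<and> F u \<noteq> 0"
    and dense: "closure D = UNIV" and zero: "0 \<in> D"
    and lim: "\<And>v. v \<in> D \<Longrightarrow> ((\<lambda>\<theta>. F (Complex v \<theta>)) \<longlongrightarrow> 0) (at_left (pi / 2))"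
  shows "\<exists>t\<ge>T. transform t = 0"
proof (rule ccontr)
  assume "\<not> (\<exists>t\<ge>T. transform t = 0)"
  then have T: "max T 0 \<ge> 0" "\<And>t. t \<ge> max T 0 \<Longrightarrow> transform t \<noteq> 0" by auto
  obtain B where B: "\<And>\<theta>. 0 \<le> \<theta> \<Longrightarrow> \<theta> < pi / 2 \<Longrightarrow> norm (F (Complex 0 \<theta>)) \<le> B"
  proof -
    have "\<forall>\<^sub>F \<theta> in at_left (pi / 2). norm (F (Complex 0 \<theta>)) < 1"
      using tendstoD[OF lim[OF zero], of 1] by simp
    then obtain c where c: "c < pi / 2" "\<And>\<theta>. c < \<theta> \<Longrightarrow> \<theta> < pi / 2 \<Longrightarrow> norm (F (Complex 0 \<theta>)) < 1"
      unfolding eventually_at_left_field by blast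
    have "continuous_on {0..c} (\<lambda>\<theta>. F (Complex 0 \<theta>))"
      unfolding Complex_eq
      by (rule continuous_on_compose2[OF holomorphic_on_imp_continuous_on[OF holo]])
         (use c in \<open>auto intro!: continuous_intros\<close>)
    then have "bounded ((\<lambda>\<theta>. F (Complex 0 \<theta>)) ` {0..c})"
      by (intro compact_imp_bounded compact_continuous_image) auto
    then obtain b where b: "\<And>\<theta>. \<theta> \<in> {0..c} \<Longrightarrow> norm (F (Complex 0 \<theta>)) \<le> b"
      unfolding bounded_iff by blast
    show thesis
    proof (rule that)
      fix \<theta> :: real assume "0 \<le> \<theta>" "\<theta> < pi / 2"
      then show "norm (F (Complex 0 \<theta>)) \<le> max b 1" using b[of \<theta>] c(2)[of \<theta>] by (cases "\<theta> \<le> c") auto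
    qed
  qed
  define w where "w t = norm (transform t) * (1 + exp (t * (pi / 2)))" for t
  have w: "integrable lborel w" unfolding w_def by (rule integrable_up_to_boundary[OF real T B])
  \<comment> \<open>Inside the strip \<open>K\<close> is 2 pi F by inversion, but the integral still
    makes sense on the line Im u = pi/2, so it provides the continuous extension.\<close>
  define K where "K u = (LINT t|lborel. transform t * exp (- (\<i> * of_real t * u)))" for u
  define S0 where "S0 = {u. 0 \<le> Im u \<and> Im u \<le> pi / 2}"
  have contK: "continuous_on S0 K"
    unfolding K_def
  proof (rule continuous_on_integral_dominated[OF _ _ w])
    fix u t assume u: "u \<in> S0"
    have "exp (t * Im u) \<le> 1 + exp (t * (pi / 2))"
    proof (cases "t \<ge> 0")
      case True
      then have "exp (t * Im u) \<le> exp (t * (pi / 2))" using u mult_left_mono[of "Im u" "pi / 2" t] by (simp add: S0_def)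
      then show ?thesis by linarith
    next
      case False
      then have "exp (t * Im u) \<le> 1" using u by (auto simp: S0_def mult_nonpos_nonneg)
      then show ?thesis by (simp add: add_increasing2)
    qed
    then show "norm (transform t * exp (- (\<i> * of_real t * u))) \<le> w t"
      unfolding norm_mult norm_exp_kernel w_def by (intro mult_left_mono) auto
  qed (use measurable_kernel in \<open>auto intro!: continuous_intros\<close>)
  have KF: "K u = 2 * pi * F u" if "0 \<le> Im u" "Im u < pi / 2" for u
    unfolding K_def by (rule transform_inversion) (use that in auto)
  have top0: "K (Complex v (pi / 2)) = 0" if v: "v \<in> D" for v
  proof -
    have "((\<lambda>\<theta>. K (Complex v \<theta>)) \<longlongrightarrow> K (Complex v (pi / 2))) (at (pi / 2) within {0..<pi / 2})"
    proof -
      have "continuous_on {0..pi / 2} (\<lambda>\<theta>. K (Complex v \<theta>))"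
        by (rule continuous_on_compose2[OF contK]) (auto simp: S0_def Complex_eq intro!: continuous_intros)
      then have "((\<lambda>\<theta>. K (Complex v \<theta>)) \<longlongrightarrow> K (Complex v (pi / 2))) (at (pi / 2) within {0..pi / 2})"
        unfolding continuous_on_def by auto
      then show ?thesis by (rule tendsto_within_subset) auto
    qed
    moreover have "at (pi / 2) within {0..<pi / 2} = at_left (pi / 2)"
      by (rule at_within_nhd[of _ "{0<..}"]) auto
    ultimately have 1: "((\<lambda>\<theta>. K (Complex v \<theta>)) \<longlongrightarrow> K (Complex v (pi / 2))) (at_left (pi / 2))" by simp
    have "((\<lambda>\<theta>. 2 * pi * F (Complex v \<theta>)) \<longlongrightarrow> of_real (2 * pi) * 0) (at_left (pi / 2))"
      by (intro tendsto_intros lim[OF v])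
    moreover have "\<forall>\<^sub>F \<theta> in at_left (pi / 2). 2 * pi * F (Complex v \<theta>) = K (Complex v \<theta>)"
      using eventually_at_left_real[of 0 "pi / 2"] by (auto elim!: eventually_mono simp: KF)
    ultimately have "((\<lambda>\<theta>. K (Complex v \<theta>)) \<longlongrightarrow> of_real (2 * pi) * 0) (at_left (pi / 2))"
      by (rule Lim_transform_eventually)
    from tendsto_unique[OF _ 1 this] show ?thesis by simp
  qed
  have top: "K (Complex v (pi / 2)) = 0" for v
  proof (rule continuous_constant_on_closure[where S = D and f = "\<lambda>v. K (Complex v (pi / 2))"])
    show "continuous_on (closure D) (\<lambda>v. K (Complex v (pi / 2)))"
      by (rule continuous_on_compose2[OF contK]) (auto simp: S0_def Complex_eq intro!: continuous_intros)
  qed (use top0 dense in auto)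
  define S where "S = {u. \<bar>Im u\<bar> < pi / 2}"
  have S_eq: "S = {u. Im u < pi / 2} \<inter> {u. Im u > - (pi / 2)}" by (auto simp: S_def)
  have "convex S" unfolding S_eq by (intro convex_Int convex_halfspace_Im_lt convex_halfspace_Im_gt)
  then have connS: "connected S" by (rule convex_connected)
  have openS: "open S" unfolding S_eq by (intro open_Int open_halfspace_Im_lt open_halfspace_Im_gt)
  \<comment> \<open>The point reflection u = i pi/2 - z maps the line Im u = pi/2 to the real axis
    and keeps the closed strip between them, which is the position needed for Schwarz reflection.
    Vanishing on the axis makes \<open>W\<close> real there.\<close>
  define W where "W z = K (\<i> * of_real (pi / 2) - z)" for z
  define g where "g z = (if 0 \<le> Im z then W z else cnj (W (cnj z)))" for z
  have W_real: "W (of_real x) = 0" for x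
    using top[of "- x"] unfolding W_def by (simp add: Complex_eq)
  have g_holo: "g holomorphic_on S"
    unfolding g_def
  proof (rule Schwarz_reflection[OF openS])
    show "cnj ` S \<subseteq> S" by (auto simp: S_def)
    show "W holomorphic_on S \<inter> {z. 0 < Im z}"
    proof (rule holomorphic_transform)
      show "(\<lambda>z. 2 * pi * F (\<i> * of_real (pi / 2) - z)) holomorphic_on S \<inter> {z. 0 < Im z}"
        by (intro holomorphic_intros holomorphic_on_compose_gen[OF _ holo, unfolded o_def]) (auto simp: S_def)
      show "2 * pi * F (\<i> * of_real (pi / 2) - z) = W z" if "z \<in> S \<inter> {z. 0 < Im z}" for z
        unfolding W_def by (rule KF[symmetric]) (use that in \<open>auto simp: S_def\<close>)
    qed
    show "continuous_on (S \<inter> {z. 0 \<le> Im z}) W"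
      unfolding W_def
      by (rule continuous_on_compose2[OF contK]) (auto simp: S0_def S_def intro!: continuous_intros)
    show "W z \<in> \<real>" if "z \<in> S" "z \<in> \<real>" for z using W_real that by (auto elim!: Reals_cases)
  qed
  have limpt: "0 islimpt (\<real> :: complex set)"
  proof -
    have "(\<lambda>n. of_real (1 / real (Suc n)) :: complex) \<longlonglongrightarrow> of_real 0"
      by (intro tendsto_of_real) real_asymp
    then show ?thesis unfolding islimpt_sequential
      by (intro exI[of _ "\<lambda>n. of_real (1 / real (Suc n)) :: complex"]) (auto simp del: of_nat_Suc)
  qed
  have gR: "g z = 0" if "z \<in> \<real>" for z using that W_real by (auto simp: g_def elim!: Reals_cases)
  have g0: "g z = 0" if "z \<in> S" for z
    by (rule analytic_continuation[of g S "\<real>" 0]) (use g_holo limpt gR openS connS that in \<open>auto simp: S_def complex_is_Real_iff\<close>)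
  \<comment> \<open>The half of \<open>g\<close> given by \<open>W\<close> sees only 0 < Im u <
    pi/2; the lower half of the strip follows by analytic continuation.\<close>
  have F0: "F u = 0" if "0 < Im u" "Im u < pi / 2" for u
  proof -
    have "g (\<i> * of_real (pi / 2) - u) = 0" by (rule g0) (use that in \<open>auto simp: S_def\<close>)
    then have "K u = 0" using that by (simp add: g_def W_def)
    then show ?thesis using KF[of u] that by simp
  qed
  have "F u = 0" if "\<bar>Im u\<bar> < pi / 2" for u
  proof (rule analytic_continuation_open[where s = "{u. 0 < Im u \<and> Im u < pi / 2}" and s' = S and f = F and g = "\<lambda>_. 0"])
    show "open {u. 0 < Im u \<and> Im u < pi / 2}"
      unfolding Collect_conj_eq by (intro open_Int open_halfspace_Im_lt open_halfspace_Im_gt)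
    have "Complex 0 1 \<in> {u. 0 < Im u \<and> Im u < pi / 2}" using pi_gt3 by simp
    then show "{u. 0 < Im u \<and> Im u < pi / 2} \<noteq> {}" by blast
  qed (use that F0 holo openS connS in \<open>auto simp: S_def\<close>)
  then show False using nz by blast
qed

end

section \<open>Cusp forms near the cusps\<close>

text \<open>By periodicity g is a function of q = e(z/P) on the punctured unit disc. It tends to 0
  at q = 0, so the singularity is removable with value 0, and a bound on the derivative gives |g|
  \<le> B |q|.\<close>

lemma periodic_decay:
  fixes g :: "complex \<Rightarrow> complex" and P :: real
  assumes P: "P > 0" and holo: "g holomorphic_on upper_half_plane"
    and per: "\<And>z n. z \<in> upper_half_plane \<Longrightarrow> g (z + of_int n * of_real P) = g z"
    and lim: "(g \<longlongrightarrow> 0) (filtercomap Im at_top)"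
  obtains C where "C \<ge> 0" "\<And>z. Im z \<ge> P \<Longrightarrow> norm (g z) \<le> C * exp (- (2 * pi * Im z / P))"
proof -
  define w where "w = of_real P / (2 * of_real pi * \<i>)"
  define h where "h q = g (w * Ln q)" for q
  have Im_w: "Im (w * z) = - (P / (2 * pi)) * Re z" for z
    using P by (simp add: w_def Im_divide complex_eq_iff field_simps power2_eq_square)
  have up: "w * Ln q \<in> upper_half_plane" if "q \<in> ball 0 1 - {0}" for q
    using that P unfolding upper_half_plane_def mem_Collect_eq Im_w by (simp add: mult_less_0_iff zero_less_mult_iff divide_neg_pos)
  have w_per: "w * (of_int n * (2 * of_real pi * \<i>)) = of_int n * of_real P" for n :: int
  proof -
    have "w * (2 * of_real pi * \<i>) = of_real P" by (simp add: w_def)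
    then show ?thesis by (subst mult.left_commute) (simp only:)
  qed
  \<comment> \<open>A second branch of the logarithm, cut along the other half-axis. The two slit
    discs cover the punctured disc, so \<open>h\<close> is holomorphic across the cut of
    \<open>Ln\<close>.\<close>
  have h_alt: "g (w * (Ln (- q) + \<i> * of_real pi)) = h q" if q: "q \<in> ball 0 1 - {0}" for q
  proof -
    have "Ln (- q) + \<i> * of_real pi = Ln q + of_int 0 * (2 * of_real pi * \<i>)
      \<or> Ln (- q) + \<i> * of_real pi = Ln q + of_int 1 * (2 * of_real pi * \<i>)"
      using Ln_minus[of q] q by (auto split: if_splits)
    then obtain n :: int where "Ln (- q) + \<i> * of_real pi = Ln q + of_int n * (2 * of_real pi * \<i>)" by blast
    then have "w * (Ln (- q) + \<i> * of_real pi) = w * Ln q + of_int n * of_real P"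
      by (simp add: w_per ring_distribs)
    then show ?thesis unfolding h_def using per[OF up[OF q]] by simp
  qed
  have "h holomorphic_on (ball 0 1 - \<real>\<^sub>\<le>\<^sub>0) \<union> (ball 0 1 - \<real>\<^sub>\<ge>\<^sub>0)"
  proof (rule holomorphic_on_Un)
    show "h holomorphic_on ball 0 1 - \<real>\<^sub>\<le>\<^sub>0"
      unfolding h_def
    proof (rule holomorphic_on_compose_gen[OF _ holo, unfolded o_def])
      show "(\<lambda>q. w * Ln q) holomorphic_on ball 0 1 - \<real>\<^sub>\<le>\<^sub>0" by (intro holomorphic_intros) auto
      show "(\<lambda>q. w * Ln q) ` (ball 0 1 - \<real>\<^sub>\<le>\<^sub>0) \<subseteq> upper_half_plane"
      proof (rule image_subsetI)
        fix q :: complex assume "q \<in> ball 0 1 - \<real>\<^sub>\<le>\<^sub>0"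
        then have "q \<in> ball 0 1 - {0}" by auto
        then show "w * Ln q \<in> upper_half_plane" by (rule up)
      qed
    qed
    show "h holomorphic_on ball 0 1 - \<real>\<^sub>\<ge>\<^sub>0"
    proof (rule holomorphic_transform)
      show "(\<lambda>q. g (w * (Ln (- q) + \<i> * of_real pi))) holomorphic_on ball 0 1 - \<real>\<^sub>\<ge>\<^sub>0"
      proof (rule holomorphic_on_compose_gen[OF _ holo, unfolded o_def])
        show "(\<lambda>q. w * (Ln (- q) + \<i> * of_real pi)) holomorphic_on ball 0 1 - \<real>\<^sub>\<ge>\<^sub>0"
          by (intro holomorphic_intros) (auto simp: complex_nonneg_Reals_iff complex_nonpos_Reals_iff)
        show "(\<lambda>q. w * (Ln (- q) + \<i> * of_real pi)) ` (ball 0 1 - \<real>\<^sub>\<ge>\<^sub>0) \<subseteq> upper_half_plane"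
        proof (rule image_subsetI)
          fix q :: complex assume q: "q \<in> ball 0 1 - \<real>\<^sub>\<ge>\<^sub>0"
          then have "- q \<in> ball 0 1 - {0}" by auto
          from up[OF this] show "w * (Ln (- q) + \<i> * of_real pi) \<in> upper_half_plane"
            unfolding upper_half_plane_def mem_Collect_eq Im_w by simp
        qed
      qed
      show "g (w * (Ln (- q) + \<i> * of_real pi)) = h q" if "q \<in> ball 0 1 - \<real>\<^sub>\<ge>\<^sub>0" for q
        using that by (intro h_alt) auto
    qed
    show "open (ball 0 1 - \<real>\<^sub>\<le>\<^sub>0 :: complex set)" "open (ball 0 1 - \<real>\<^sub>\<ge>\<^sub>0 :: complex set)"
      by (intro open_Diff closed_nonpos_Reals_complex closed_nonneg_Reals_complex open_ball)+
  qed
  moreover have "(ball 0 1 - \<real>\<^sub>\<le>\<^sub>0) \<union> (ball 0 1 - \<real>\<^sub>\<ge>\<^sub>0) = ball 0 1 - {0 :: complex}"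
    by (auto simp: complex_nonneg_Reals_iff complex_nonpos_Reals_iff complex_eq_iff)
  ultimately have h_holo: "h holomorphic_on ball 0 1 - {0}" by simp
  have h_lim: "h \<midarrow>0\<rightarrow> 0"
    unfolding h_def
  proof (rule filterlim_compose[OF lim])
    have "filterlim (\<lambda>q. Im (w * Ln q)) at_top (at 0)"
    proof -
      have "filterlim (\<lambda>q::complex. norm q) (at_right 0) (at 0)"
        by (auto simp: filterlim_at tendsto_norm_zero_iff eventually_at_filter intro!: tendsto_eq_intros)
      then have "filterlim (\<lambda>q::complex. ln (norm q)) at_bot (at 0)" by (rule filterlim_compose[OF ln_at_0])
      then have "filterlim (\<lambda>q::complex. - (P / (2 * pi)) * ln (norm q)) at_top (at 0)"
        using P by (subst filterlim_tendsto_neg_mult_at_top_iff) (auto simp: filterlim_uminus_at_top)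
      moreover have "\<forall>\<^sub>F q in at 0. - (P / (2 * pi)) * ln (norm q) = Im (w * Ln q)"
        unfolding Im_w by (auto simp: eventually_at_filter)
      ultimately show ?thesis by (rule filterlim_mono_eventually[OF _ order_refl order_refl])
    qed
    then show "filterlim (\<lambda>q. w * Ln q) (filtercomap Im at_top) (at 0)"
      by (simp add: filterlim_filtercomap_iff o_def)
  qed
  define H where "H q = (if q = 0 then 0 else h q)" for q
  have H: "H holomorphic_on ball 0 1"
    unfolding H_def by (rule removable_singularity[OF h_holo _ h_lim]) auto
  then have "deriv H holomorphic_on ball 0 1" by (rule holomorphic_deriv) auto
  then have "continuous_on (cball 0 (1/2)) (deriv H)"
    by (rule continuous_on_subset[OF holomorphic_on_imp_continuous_on]) auto
  then have "bounded (deriv H ` cball 0 (1/2))"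
    by (intro compact_imp_bounded compact_continuous_image) auto
  then obtain B where B: "\<And>q. q \<in> cball 0 (1/2) \<Longrightarrow> norm (deriv H q) \<le> B"
    unfolding bounded_iff by blast
  have B0: "B \<ge> 0" using order_trans[OF norm_ge_zero B[of 0]] by simp
  show thesis
  proof (rule that[OF B0])
    fix z assume z: "Im z \<ge> P"
    define q where "q = exp (2 * of_real pi * \<i> * z / of_real P)"
    have nq: "norm q = exp (- (2 * pi * Im z / P))" by (simp add: q_def)
    \<comment> \<open>The assumption Im z \<ge> P puts q into the disc of radius 1/2, a compact set
      on which \<open>deriv H\<close> is bounded.\<close>
    have "1 * Im z \<le> (2 * pi) * Im z" using z P pi_gt3 by (intro mult_right_mono) auto
    then have "P \<le> 2 * pi * Im z" using z by simp
    then have "norm q \<le> exp (- 1)" unfolding nq using P by (simp add: pos_le_divide_eq)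
    also have "\<dots> \<le> 1 / 2" using exp_ge_add_one_self[of 1] by (simp add: exp_minus field_simps)
    finally have q: "q \<in> cball 0 (1/2)" by simp
    have "norm (H q - H 0) \<le> B * norm (q - 0)"
    proof (rule field_differentiable_bound)
      show "(H has_field_derivative deriv H z) (at z within cball 0 (1/2))" if "z \<in> cball 0 (1/2)" for z
        using that by (intro has_field_derivative_at_within[OF holomorphic_derivI[OF H]]) auto
    qed (use B q in auto)
    moreover have "H q = g z"
    proof -
      have "q \<noteq> 0" by (simp add: q_def)
      then have "exp (Ln q) = exp (2 * of_real pi * \<i> * z / of_real P)" by (simp add: q_def)
      then obtain n :: int where n: "Ln q = 2 * of_real pi * \<i> * z / of_real P + of_real (of_int (2 * n) * pi) * \<i>"
        unfolding exp_eq by blast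
      have "w * Ln q = w * (2 * of_real pi * \<i> * z / of_real P) + w * (of_int n * (2 * of_real pi * \<i>))"
        unfolding n by (simp add: ring_distribs mult_ac)
      also have "w * (2 * of_real pi * \<i> * z / of_real P) = z"
        using P by (simp add: w_def)
      finally have "w * Ln q = z + of_int n * of_real P" by (simp only: w_per)
      then show ?thesis using per[of z n] z P \<open>q \<noteq> 0\<close>
        by (simp add: H_def h_def upper_half_plane_def)
    qed
    ultimately show "norm (g z) \<le> B * exp (- (2 * pi * Im z / P))" using nq by (simp add: H_def)
  qed
qed

section \<open>Slash operators and the action of the modular group\<close>

lemma moebius_denominator_nonzero:
  assumes "Im z > 0" "(c, d) \<noteq> (0, 0 :: int)"
  shows "of_int c * z + of_int d \<noteq> 0"
proof
  assume *: "of_int c * z + of_int d = 0"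
  then have "of_int c * Im z = 0" by (simp add: complex_eq_iff)
  then have "c = 0" using assms(1) by simp
  then show False using * assms by simp
qed

lemma moebius_denominator_nonzero':
  fixes a b c d :: int
  assumes "a * d - b * c = 1" "Im z > 0"
  shows "of_int c * z + of_int d \<noteq> 0"
  using assms by (intro moebius_denominator_nonzero) auto

lemma Im_moebius:
  fixes a b c d :: int
  assumes "a * d - b * c = 1" "Im z > 0"
  shows "Im ((of_int a * z + of_int b) / (of_int c * z + of_int d)) = Im z / (norm (of_int c * z + of_int d))\<^sup>2"
proof -
  have "real_of_int a * real_of_int d - real_of_int b * real_of_int c = 1"
    using assms(1) by (simp flip: of_int_mult of_int_diff)
  then have "Im (of_int a * z + of_int b) * Re (of_int c * z + of_int d) - Re (of_int a * z + of_int b) * Im (of_int c * z + of_int d) = Im z"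
    by simp algebra
  then show ?thesis by (simp add: Im_divide cmod_power2)
qed

lemma bezout_det:
  fixes a c :: int
  assumes "coprime a c"
  obtains b d where "a * d - b * c = 1"
proof -
  obtain u v where "u * a + v * c = gcd a c" using bezout_int by blast
  then show thesis using assms by (intro that[of u "- v"]) (simp add: mult.commute)
qed

text \<open>The operator \<open>slash\<close> with the entries as separate integers, so that
  products and inverses of matrices become plain integer algebra.\<close>

definition slash_int :: "nat \<Rightarrow> (complex \<Rightarrow> complex) \<Rightarrow> int \<Rightarrow> int \<Rightarrow> int \<Rightarrow> int \<Rightarrow> complex \<Rightarrow> complex" where
  "slash_int k f a b c d z = f ((of_int a * z + of_int b) / (of_int c * z + of_int d)) / (of_int c * z + of_int d) ^ k"

locale cusp_form =
  fixes k N :: nat and f :: "complex \<Rightarrow> complex"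
  assumes N: "N > 0" and f: "f \<in> cusp_forms k N"
begin

lemma holo: "f holomorphic_on upper_half_plane"
  using f by (simp add: cusp_forms_def)

lemma invariant:
  fixes a b c d :: int
  assumes "a * d - b * c = 1" "int N dvd c" "Im z > 0"
  shows "f ((of_int a * z + of_int b) / (of_int c * z + of_int d)) = (of_int c * z + of_int d) ^ k * f z"
proof -
  define A :: "int^2^2" where "A = vector [vector [a, b], vector [c, d]]"
  have "A \<in> Gamma0 N" using assms by (simp add: Gamma0_def SL2Z_def A_def det_2)
  moreover have "\<forall>A\<in>Gamma0 N. \<forall>z\<in>upper_half_plane. slash k A f z = f z"
    using f unfolding cusp_forms_def by blast
  ultimately have "slash k A f z = f z" using assms(3) by (simp add: upper_half_plane_def)
  then have "f ((of_int a * z + of_int b) / (of_int c * z + of_int d)) / (of_int c * z + of_int d) ^ k = f z"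
    by (simp add: slash_def moebius_def A_def)
  moreover have "of_int c * z + of_int d \<noteq> 0"
    using assms by (intro moebius_denominator_nonzero') auto
  ultimately show ?thesis by (simp add: field_simps)
qed

lemma slash_int_limit:
  assumes "a * d - b * c = 1"
  shows "(slash_int k f a b c d \<longlongrightarrow> 0) (filtercomap Im at_top)"
proof -
  define A :: "int^2^2" where "A = vector [vector [a, b], vector [c, d]]"
  have "A \<in> SL2Z" using assms by (simp add: SL2Z_def A_def det_2)
  moreover have "\<forall>A\<in>SL2Z. (slash k A f \<longlongrightarrow> 0) (filtercomap Im at_top)"
    using f unfolding cusp_forms_def by blast
  ultimately have "(slash k A f \<longlongrightarrow> 0) (filtercomap Im at_top)" by blast
  moreover have "slash k A f = slash_int k f a b c d"
    by (simp add: fun_eq_iff slash_def moebius_def A_def slash_int_def)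
  ultimately show ?thesis by simp
qed

lemma slash_int_holomorphic:
  assumes "a * d - b * c = 1"
  shows "slash_int k f a b c d holomorphic_on upper_half_plane"
  unfolding slash_int_def
proof (intro holomorphic_intros)
  have nz: "of_int c * z + of_int d \<noteq> 0" if "z \<in> upper_half_plane" for z
    using moebius_denominator_nonzero'[OF assms] that by (simp add: upper_half_plane_def)
  show "(\<lambda>z. f ((of_int a * z + of_int b) / (of_int c * z + of_int d))) holomorphic_on upper_half_plane"
  proof (rule holomorphic_on_compose_gen[OF _ holo, unfolded o_def])
    show "(\<lambda>z. (of_int a * z + of_int b) / (of_int c * z + of_int d)) holomorphic_on upper_half_plane"
      by (intro holomorphic_intros nz)
    show "(\<lambda>z. (of_int a * z + of_int b) / (of_int c * z + of_int d)) ` upper_half_plane \<subseteq> upper_half_plane"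
      using Im_moebius[OF assms] nz by (auto simp: upper_half_plane_def)
  qed
  show "(of_int c * z + of_int d) ^ k \<noteq> 0" if "z \<in> upper_half_plane" for z using nz[OF that] by simp
qed

text \<open>For matrices A and A' with these entries, the quotient A A'^(-1) has lower left entry c
  d' - d c', divisible by N when the bottom rows agree modulo N. Hence A and A' lie in the same
  coset of \<Gamma>0(N), on which slashing f is constant.\<close>

lemma slash_int_coset:
  assumes 1: "a * d - b * c = 1" and 2: "a' * d' - b' * c' = 1"
    and c: "[c = c'] (mod int N)" and d: "[d = d'] (mod int N)" and z: "Im z > 0"
  shows "slash_int k f a b c d z = slash_int k f a' b' c' d' z"
proof -
  define J where "J = of_int c * z + of_int d"
  define J' where "J' = of_int c' * z + of_int d'"
  define w where "w = (of_int a' * z + of_int b') / J'"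
  have J: "J \<noteq> 0" and J': "J' \<noteq> 0"
    unfolding J_def J'_def by (rule moebius_denominator_nonzero'[OF 1 z] moebius_denominator_nonzero'[OF 2 z])+
  have w: "Im w > 0" unfolding w_def J'_def using J' Im_moebius[OF 2 z] z by (simp add: J'_def)
  have two': "of_int a' * of_int d' - of_int b' * of_int c' = (1 :: complex)"
    using 2 by (simp flip: of_int_mult of_int_diff)
  \<comment> \<open>The cocycle relation: the automorphy factor of the quotient matrix at w = A'z is
    the quotient of the factors of A and A' at z.\<close>
  have den: "of_int (c * d' - d * c') * w + of_int (d * a' - c * b') = J / J'"
  proof -
    have "(of_int (c * d' - d * c') * w + of_int (d * a' - c * b')) * J' = J"
    proof -
      have "(of_int (c * d' - d * c') * w + of_int (d * a' - c * b')) * J'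
        = of_int (c * d' - d * c') * (w * J') + of_int (d * a' - c * b') * J'" by (simp add: algebra_simps)
      also have "w * J' = of_int a' * z + of_int b'" using J' by (simp add: w_def)
      also have "of_int (c * d' - d * c') * (of_int a' * z + of_int b') + of_int (d * a' - c * b') * J'
        = (of_int a' * of_int d' - of_int b' * of_int c') * (of_int c * z + of_int d)"
        by (simp add: J'_def algebra_simps)
      finally show ?thesis by (simp add: two' J_def)
    qed
    then show ?thesis using J' by (simp add: field_simps)
  qed
  have num: "of_int (a * d' - b * c') * w + of_int (b * a' - a * b') = (of_int a * z + of_int b) / J'"
  proof -
    have "(of_int (a * d' - b * c') * w + of_int (b * a' - a * b')) * J' = of_int a * z + of_int b"
    proof -
      have "(of_int (a * d' - b * c') * w + of_int (b * a' - a * b')) * J'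
        = of_int (a * d' - b * c') * (w * J') + of_int (b * a' - a * b') * J'" by (simp add: algebra_simps)
      also have "w * J' = of_int a' * z + of_int b'" using J' by (simp add: w_def)
      also have "of_int (a * d' - b * c') * (of_int a' * z + of_int b') + of_int (b * a' - a * b') * J'
        = (of_int a' * of_int d' - of_int b' * of_int c') * (of_int a * z + of_int b)"
        by (simp add: J'_def algebra_simps)
      finally show ?thesis by (simp add: two')
    qed
    then show ?thesis using J' by (simp add: field_simps)
  qed
  have "f ((of_int (a * d' - b * c') * w + of_int (b * a' - a * b')) / (of_int (c * d' - d * c') * w + of_int (d * a' - c * b')))
      = (of_int (c * d' - d * c') * w + of_int (d * a' - c * b')) ^ k * f w"
  proof (rule invariant[OF _ _ w])
    have "(a * d' - b * c') * (d * a' - c * b') - (b * a' - a * b') * (c * d' - d * c') = (a * d - b * c) * (a' * d' - b' * c')"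
      by algebra
    then show "(a * d' - b * c') * (d * a' - c * b') - (b * a' - a * b') * (c * d' - d * c') = 1" using 1 2 by simp
    have "[c * d' - d * c' = c' * d' - d' * c'] (mod int N)" using c d by (intro cong_diff cong_mult) auto
    then show "int N dvd c * d' - d * c'" by (simp add: cong_0_iff mult.commute)
  qed
  then have "f ((of_int a * z + of_int b) / J) = (J / J') ^ k * f w"
    unfolding den num using J J' by simp
  then show ?thesis
    unfolding slash_int_def using J J' by (simp add: w_def J_def[symmetric] J'_def[symmetric] power_divide)
qed

text \<open>Translation by nN multiplies the matrix on the right by a unipotent one, which keeps c
  and changes d by a multiple of N. The period N therefore works at every cusp, whatever its true
  width.\<close>

lemma slash_int_periodic:
  assumes 1: "a * d - b * c = 1" and z: "Im z > 0"
  shows "slash_int k f a b c d (z + of_int n * of_real (real N)) = slash_int k f a b c d z"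
proof -
  have "slash_int k f a (b + a * (n * int N)) c (d + c * (n * int N)) z = slash_int k f a b c d z"
  proof (rule slash_int_coset[OF _ 1 _ _ z])
    show "a * (d + c * (n * int N)) - (b + a * (n * int N)) * c = 1" using 1 by (simp add: algebra_simps)
    show "[d + c * (n * int N) = d] (mod int N)" by (simp add: cong_def flip: mult.assoc)
  qed simp
  then show ?thesis by (simp add: slash_int_def algebra_simps)
qed

lemma slash_int_decay:
  assumes "a * d - b * c = 1"
  obtains C where "C \<ge> 0" "\<And>z. Im z \<ge> real N \<Longrightarrow> norm (slash_int k f a b c d z) \<le> C * exp (- (2 * pi * Im z / real N))"
proof (rule periodic_decay[of "real N" "slash_int k f a b c d"])
  show "slash_int k f a b c d (z + of_int n * of_real (real N)) = slash_int k f a b c d z" if "z \<in> upper_half_plane" for z n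
    using that by (intro slash_int_periodic assms) (simp add: upper_half_plane_def)
qed (use N assms slash_int_holomorphic slash_int_limit that in auto)

text \<open>High up the function is small because it vanishes at the cusp; below that, periodicity
  moves z into a compact rectangle.\<close>

lemma slash_int_bounded:
  assumes 1: "a * d - b * c = 1" and \<eta>: "\<eta> > 0"
  shows "\<exists>M. \<forall>z. Im z \<ge> \<eta> \<longrightarrow> norm (slash_int k f a b c d z) \<le> M"
proof -
  let ?g = "slash_int k f a b c d"
  have "\<forall>\<^sub>F z in filtercomap Im at_top. norm (?g z) < 1"
    using tendstoD[OF slash_int_limit[OF 1], of 1] by simp
  then obtain Y where Y: "\<And>z. Im z \<ge> Y \<Longrightarrow> norm (?g z) < 1"
    unfolding eventually_filtercomap eventually_at_top_linorder by blast
  define R where "R = cbox (Complex 0 \<eta>) (Complex (real N) Y)"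
  have "R \<subseteq> upper_half_plane" using \<eta> by (auto simp: R_def upper_half_plane_def in_cbox_complex_iff)
  then have "continuous_on R ?g"
    using holomorphic_on_imp_continuous_on[OF slash_int_holomorphic[OF 1]] continuous_on_subset by blast
  then have "bounded (?g ` R)"
    unfolding R_def by (intro compact_imp_bounded compact_continuous_image compact_cbox)
  then obtain B where B: "\<And>z. z \<in> R \<Longrightarrow> norm (?g z) \<le> B" unfolding bounded_iff by blast
  show ?thesis
  proof (intro exI[of _ "max B 1"] allI impI)
    fix z assume z: "Im z \<ge> \<eta>"
    show "norm (?g z) \<le> max B 1"
    proof (cases "Im z \<ge> Y")
      case True then show ?thesis using Y[of z] by simp
    next
      case False
      define n where "n = \<lfloor>Re z / real N\<rfloor>"
      have "of_int n * real N \<le> Re z" "Re z \<le> (of_int n + 1) * real N"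
        unfolding n_def using N by (simp_all add: pos_le_divide_eq[symmetric] pos_divide_le_eq[symmetric])
      then have "z + of_int (- n) * of_real (real N) \<in> R"
        using z False by (auto simp: R_def in_cbox_complex_iff algebra_simps)
      then have "norm (?g (z + of_int (- n) * of_real (real N))) \<le> B" by (rule B)
      moreover have "?g (z + of_int (- n) * of_real (real N)) = ?g z"
        using z \<eta> by (intro slash_int_periodic 1) auto
      ultimately show ?thesis by simp
    qed
  qed
qed

text \<open>There are only finitely many cosets of $\Gamma_0(N)$, distinguished by the bottom row modulo $N$.\<close>
lemma slash_int_uniformly_bounded:
  assumes \<eta>: "\<eta> > 0"
  obtains M where "M \<ge> 0" "\<And>a b c d z. a * d - b * c = 1 \<Longrightarrow> Im z \<ge> \<eta> \<Longrightarrow> norm (slash_int k f a b c d z) \<le> M"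
proof -
  define I where "I = {0..<int N} \<times> {0..<int N}"
  define P where "P p M \<longleftrightarrow> (\<forall>a b c d z. a * d - b * c = 1 \<longrightarrow> (c mod int N, d mod int N) = p \<longrightarrow> Im z \<ge> \<eta>
     \<longrightarrow> norm (slash_int k f a b c d z) \<le> M)" for p M
  have "\<forall>p\<in>I. \<exists>M. P p M"
  proof
    fix p assume "p \<in> I"
    show "\<exists>M. P p M"
    proof (cases "\<exists>a b c d. a * d - b * c = 1 \<and> (c mod int N, d mod int N) = p")
      case True
      then obtain a b c d where 1: "a * d - b * c = 1" and p: "(c mod int N, d mod int N) = p" by blast
      obtain M where M: "\<And>z. Im z \<ge> \<eta> \<Longrightarrow> norm (slash_int k f a b c d z) \<le> M"
        using slash_int_bounded[OF 1 \<eta>] by blast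
      have "P p M"
        unfolding P_def
      proof (intro allI impI)
        fix a' b' c' d' :: int and z assume 2: "a' * d' - b' * c' = 1" and p': "(c' mod int N, d' mod int N) = p" and z: "Im z \<ge> \<eta>"
        have "slash_int k f a' b' c' d' z = slash_int k f a b c d z"
          using 1 2 p p' z \<eta> by (intro slash_int_coset) (auto simp: cong_def)
        then show "norm (slash_int k f a' b' c' d' z) \<le> M" using M[OF z] by simp
      qed
      then show ?thesis by blast
    next
      case False
      then have "P p 0" unfolding P_def by blast
      then show ?thesis by blast
    qed
  qed
  then obtain m where m: "\<And>p. p \<in> I \<Longrightarrow> P p (m p)" by metis
  show thesis
  proof (rule that)
    show "(\<Sum>p\<in>I. \<bar>m p\<bar>) \<ge> 0" by (intro sum_nonneg) auto
    fix a b c d :: int and z assume 1: "a * d - b * c = 1" and z: "Im z \<ge> \<eta>"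
    define p where "p = (c mod int N, d mod int N)"
    have p: "p \<in> I" using N by (simp add: p_def I_def)
    have "norm (slash_int k f a b c d z) \<le> m p"
      using m[OF p] 1 z unfolding P_def p_def by blast
    also have "\<dots> \<le> \<bar>m p\<bar>" by simp
    also have "\<dots> \<le> (\<Sum>p\<in>I. \<bar>m p\<bar>)" by (rule member_le_sum) (use p in \<open>auto simp: I_def\<close>)
    finally show "norm (slash_int k f a b c d z) \<le> (\<Sum>p\<in>I. \<bar>m p\<bar>)" .
  qed
qed

text \<open>Here w is the image of z under the inverse matrix (d, -b; -c, a), whose automorphy
  factor is a - cz. If z is near the cusp a/c, this factor is small and w lies high up, so f near a
  cusp is read off from a slashed function near infinity.\<close>

lemma slash_int_inverse:
  fixes a b c d :: int
  assumes "a * d - b * c = 1" "Im z > 0"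
  defines "w \<equiv> (of_int d * z - of_int b) / (of_int a - of_int c * z)"
  shows "f z = slash_int k f a b c d w / (of_int a - of_int c * z) ^ k"
    and "Im w = Im z / (norm (of_int a - of_int c * z))\<^sup>2"
proof -
  have J: "of_int a - of_int c * z \<noteq> 0"
    using moebius_denominator_nonzero'[of d a "- b" "- c" z] assms(1,2) by (simp add: mult.commute)
  have 1: "of_int a * of_int d - of_int b * of_int c = (1 :: complex)"
    using assms(1) by (simp flip: of_int_mult of_int_diff)
  have den: "of_int c * w + of_int d = 1 / (of_int a - of_int c * z)"
    using J 1 unfolding w_def by (simp add: field_simps)
  have num: "of_int a * w + of_int b = z / (of_int a - of_int c * z)"
    using J 1 unfolding w_def by (simp add: field_simps)
  show "f z = slash_int k f a b c d w / (of_int a - of_int c * z) ^ k"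
  proof -
    have "z / (of_int a - of_int c * z) / (1 / (of_int a - of_int c * z)) = z" using J by simp
    then show ?thesis unfolding slash_int_def den num using J by (simp only: power_one_over) simp
  qed
  show "Im w = Im z / (norm (of_int a - of_int c * z))\<^sup>2"
    using Im_moebius[of d a "- b" "- c" z] assms(1,2) unfolding w_def by (simp add: mult.commute)
qed

text \<open>Dirichlet approximation of Re z yields a fraction a/c whose matrix moves z to height at
  least 1/5, where all slashed functions share one bound. The price is the automorphy factor |a -
  cz|^(-k), at most y^(-k). The exponent is generous, as only polynomial growth matters.\<close>

lemma polynomial_bound:
  obtains M where "M \<ge> 0" "\<And>z. 0 < Im z \<Longrightarrow> Im z \<le> 1 \<Longrightarrow> norm (f z) \<le> M / Im z ^ k"
proof -
  have "(1 / 5 :: real) > 0" by simp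
  from slash_int_uniformly_bounded[OF this] obtain M where M: "M \<ge> 0"
    "\<And>a b c d z. a * d - b * c = 1 \<Longrightarrow> Im z \<ge> 1 / 5 \<Longrightarrow> norm (slash_int k f a b c d z) \<le> M" by metis
  show thesis
  proof (rule that[OF M(1)])
    fix z assume z: "0 < Im z" "Im z \<le> 1"
    define x where "x = Re z"
    define y where "y = Im z"
    have y: "0 < y" "y \<le> 1" using z by (auto simp: y_def)
    \<comment> \<open>Denominators up to 1/sqrt y balance the two parts of |a - cz|^2: the imaginary
      part gives (cy)^2 \<le> y. The real part gives 4y, where the 4 comes from rounding R down to
      the integer n. Their sum 5y is the origin of the height 1/5.\<close>
    define R where "R = 1 / sqrt y"
    have R: "R \<ge> 1" using y by (simp add: R_def real_le_lsqrt)
    have R2: "R\<^sup>2 = 1 / y" using y by (simp add: R_def power_divide)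
    define n where "n = nat \<lfloor>R\<rfloor>"
    have n: "n > 0" "real n \<le> R" "R \<le> 2 * real n"
    proof -
      have "real n = of_int \<lfloor>R\<rfloor>" "\<lfloor>R\<rfloor> \<ge> 1" using R by (simp_all add: n_def)
      then show "n > 0" "real n \<le> R" "R \<le> 2 * real n" by linarith+
    qed
    obtain a c where ac: "coprime a c" "0 < c" "c \<le> int n" "\<bar>of_int c * x - of_int a\<bar> < 1 / real n"
      using Dirichlet_approx_coprime[OF n(1)] by metis
    obtain b d where det: "a * d - b * c = 1" using bezout_det[OF ac(1)] by blast
    define J where "J = of_int a - of_int c * z"
    have c: "of_int c \<le> R" "real_of_int c \<ge> 1" using ac(2,3) n(2) by linarith+
    have "\<bar>of_int c * x - of_int a\<bar> \<le> 2 / R"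
    proof -
      have "2 / (2 * real n) \<le> 2 / R" using n R by (intro divide_left_mono) auto
      then show ?thesis using ac(4) by linarith
    qed
    then have "\<bar>of_int c * x - of_int a\<bar>\<^sup>2 \<le> (2 / R)\<^sup>2" by (intro power_mono) auto
    then have 1: "(of_int a - of_int c * x)\<^sup>2 \<le> 4 * y" using R2 y by (simp add: power_divide power2_commute)
    have "(of_int c)\<^sup>2 \<le> R\<^sup>2" using c by (intro power_mono) auto
    then have "(of_int c)\<^sup>2 * y\<^sup>2 \<le> (1 / y) * y\<^sup>2" using y unfolding R2 by (intro mult_right_mono) auto
    then have 2: "(of_int c * y)\<^sup>2 \<le> y" using y by (simp add: power2_eq_square mult_ac)
    have "(norm J)\<^sup>2 = (of_int a - of_int c * x)\<^sup>2 + (of_int c * y)\<^sup>2"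
      by (simp add: J_def cmod_power2 x_def y_def)
    then have J5: "(norm J)\<^sup>2 \<le> 5 * y" using 1 2 by linarith
    \<comment> \<open>As c \<ge> 1, the imaginary part alone bounds the automorphy factor from
      below.\<close>
    have "of_int c * y \<le> norm J" using abs_Im_le_cmod[of J] c y by (simp add: J_def y_def)
    moreover have "1 * y \<le> of_int c * y" using c y by (intro mult_right_mono) auto
    ultimately have Jy: "y \<le> norm J" by linarith
    have J0: "norm J > 0" using Jy y by linarith
    have "1 / 5 \<le> y / (norm J)\<^sup>2" using J5 J0 by (simp add: field_simps)
    then have "norm (slash_int k f a b c d ((of_int d * z - of_int b) / J)) \<le> M"
      using slash_int_inverse(2)[OF det z(1)] unfolding J_def y_def by (intro M(2)[OF det]) simp
    then have "norm (f z) \<le> M / norm J ^ k"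
      using J0 unfolding slash_int_inverse(1)[OF det z(1)] J_def[symmetric] by (simp add: norm_divide norm_power divide_right_mono)
    also have "\<dots> \<le> M / y ^ k" using M(1) Jy y J0 by (intro divide_left_mono power_mono) auto
    finally show "norm (f z) \<le> M / Im z ^ k" by (simp add: y_def)
  qed
qed

text \<open>The region is a cone with vertex at the cusp. In it the height of the transformed point
  w is at least a constant over r = |z - x|, so the decay at infinity gives e^(-\<kappa>/r), which
  beats the factor r^(-k).\<close>

lemma cusp_limit:
  fixes a c :: int
  assumes "coprime a c" "c > 0"
  defines "x \<equiv> of_int a / of_int c :: complex"
  shows "(f \<longlongrightarrow> 0) (at x within {z. norm (z - x) \<le> 2 * Im z})"
proof -
  obtain b d where det: "a * d - b * c = 1" using bezout_det[OF assms(1)] by blast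
  obtain C where C: "C \<ge> 0" "\<And>z. Im z \<ge> real N \<Longrightarrow> norm (slash_int k f a b c d z) \<le> C * exp (- (2 * pi * Im z / real N))"
    using slash_int_decay[OF det] by metis
  define S where "S = {z. norm (z - x) \<le> 2 * Im z}"
  define c' where "c' = real_of_int c"
  have c': "c' > 0" using assms(2) by (simp add: c'_def)
  \<comment> \<open>From 2 pi Im w / N with Im w \<ge> 1 / (2 c^2 r).\<close>
  define \<kappa> where "\<kappa> = pi / (c'\<^sup>2 * real N)"
  have \<kappa>: "\<kappa> > 0" using c' N by (simp add: \<kappa>_def)
  define \<phi> where "\<phi> r = C * exp (- (\<kappa> / r)) / (c' * r) ^ k" for r
  have "(\<phi> \<longlongrightarrow> 0) (at_right 0)"
    unfolding \<phi>_def using \<kappa> c' by real_asymp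
  moreover have "filterlim (\<lambda>z. norm (z - x)) (at_right 0) (at x within S)"
    by (auto simp: filterlim_at eventually_at_filter intro!: tendsto_eq_intros)
  ultimately have lim: "((\<lambda>z. \<phi> (norm (z - x))) \<longlongrightarrow> 0) (at x within S)" by (rule filterlim_compose)
  have "\<forall>\<^sub>F z in at x within S. norm (f z) \<le> \<phi> (norm (z - x))"
    unfolding eventually_at
  \<comment> \<open>This radius makes the lower bound for Im w at least N, the range in which the
    decay estimate holds.\<close>
  proof (intro exI[of _ "1 / (2 * c'\<^sup>2 * real N)"] conjI ballI impI)
    show "1 / (2 * c'\<^sup>2 * real N) > 0" using c' N by simp
    fix z assume z: "z \<in> S" "z \<noteq> x \<and> dist z x < 1 / (2 * c'\<^sup>2 * real N)"
    define r where "r = norm (z - x)"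
    have r: "r > 0" "r < 1 / (2 * c'\<^sup>2 * real N)" "r \<le> 2 * Im z" using z by (auto simp: r_def dist_norm S_def)
    then have Imz: "Im z > 0" by linarith
    define w where "w = (of_int d * z - of_int b) / (of_int a - of_int c * z)"
    have J: "norm (of_int a - of_int c * z) = c' * r"
    proof -
      have "of_int a - of_int c * z = - (of_int c * (z - x))" using assms(2) by (simp add: x_def field_simps)
      then show ?thesis using c' by (simp add: norm_mult r_def c'_def)
    qed
    have Im_w: "Im w \<ge> 1 / (2 * c'\<^sup>2 * r)"
    proof -
      have "1 / (2 * c'\<^sup>2 * r) = (r / 2) / (c' * r)\<^sup>2" using r c' by (simp add: field_simps power2_eq_square)
      also have "\<dots> \<le> Im z / (c' * r)\<^sup>2" using r by (intro divide_right_mono) auto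
      finally show ?thesis using slash_int_inverse(2)[OF det Imz] by (simp add: w_def J)
    qed
    have "real N \<le> 1 / (2 * c'\<^sup>2 * r)" using r c' N by (simp add: field_simps)
    then have "norm (slash_int k f a b c d w) \<le> C * exp (- (2 * pi * Im w / real N))" using Im_w by (intro C(2)) linarith
    also have "\<dots> \<le> C * exp (- (\<kappa> / r))"
    proof -
      have "\<kappa> / r = 2 * pi * (1 / (2 * c'\<^sup>2 * r)) / real N" unfolding \<kappa>_def by simp
      also have "\<dots> \<le> 2 * pi * Im w / real N"
        by (rule divide_right_mono[OF mult_left_mono[OF Im_w]]) auto
      finally show ?thesis using C(1) by (intro mult_left_mono) auto
    qed
    finally have le: "norm (slash_int k f a b c d w) \<le> C * exp (- (\<kappa> / r))" .
    have "norm (f z) = norm (slash_int k f a b c d w) / (c' * r) ^ k"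
      unfolding slash_int_inverse(1)[OF det Imz] w_def[symmetric] by (simp only: norm_divide norm_power J)
    also have "\<dots> \<le> C * exp (- (\<kappa> / r)) / (c' * r) ^ k"
      using r c' by (intro divide_right_mono le) auto
    finally have "norm (f z) \<le> C * exp (- (\<kappa> / r)) / (c' * r) ^ k" .
    then show "norm (f z) \<le> \<phi> (norm (z - x))" by (simp add: \<phi>_def r_def)
  qed
  then show ?thesis using lim unfolding S_def by (rule Lim_null_comparison)
qed

end

section \<open>The q-expansion: coefficient bounds, decay and nonvanishing\<close>

locale fourier_cusp_form = cusp_form +
  fixes a :: "nat \<Rightarrow> complex"
  assumes fourier: "has_normalized_fourier_expansion k f a"
begin

text \<open>The value 0 at n = 0 turns the series over n \<ge> 1 into a power series in q = e(z) and
  encodes vanishing at infinity.\<close>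

definition coeff :: "nat \<Rightarrow> complex" where
  "coeff n = (if n = 0 then 0 else a n * of_real (real n powr ((real k - 1) / 2)))"

definition P :: "complex fps" where "P = Abs_fps coeff"

lemma e2pii_power: "e2pii (of_nat n * z) = e2pii z ^ n"
  by (simp add: e2pii_def exp_of_nat_mult[symmetric] mult_ac)

lemma norm_e2pii: "norm (e2pii z) = exp (- (2 * pi * Im z))"
  by (simp add: e2pii_def)

lemma coeff_sums:
  assumes "Im z > 0"
  shows "(\<lambda>n. coeff n * e2pii z ^ n) sums f z"
proof -
  have "(\<lambda>n. coeff (Suc n) * e2pii z ^ Suc n) sums f z"
    using fourier assms unfolding has_normalized_fourier_expansion_def coeff_def upper_half_plane_def e2pii_power by auto
  then show ?thesis by (subst (asm) sums_Suc_iff) (simp add: coeff_def)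
qed

lemma e2pii_surj:
  assumes "0 < norm q" "norm q < 1"
  obtains z where "Im z > 0" "e2pii z = q" "Im z = - ln (norm q) / (2 * pi)"
proof -
  define z where "z = Ln q / (2 * of_real pi * \<i>)"
  have "e2pii z = q" using assms by (simp add: e2pii_def z_def)
  moreover from this have "Im z = - ln (norm q) / (2 * pi)" by (auto simp: norm_e2pii)
  ultimately show thesis using assms by (intro that) (auto simp: divide_neg_pos)
qed

lemma conv_radius: "fps_conv_radius P \<ge> 1"
  unfolding fps_conv_radius_def
proof (rule conv_radius_geI_ex)
  fix r :: real assume r: "0 < r" "ereal r < 1"
  have "0 < norm (of_real r :: complex)" "norm (of_real r :: complex) < 1" using r by auto
  from e2pii_surj[OF this] obtain z where z: "Im z > 0" "e2pii z = of_real r" by blast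
  have "summable (\<lambda>n. fps_nth P n * of_real r ^ n)"
    using sums_summable[OF coeff_sums[OF z(1)]] unfolding z(2) P_def by simp
  then show "\<exists>z. norm z = r \<and> summable (\<lambda>n. fps_nth P n * z ^ n)"
    using r(1) by (intro exI[of _ "of_real r"]) simp
qed

lemma in_conv_radius: "norm (q :: complex) < 1 \<Longrightarrow> ereal (norm q) < fps_conv_radius P"
  using conv_radius less_le_trans[of "ereal (norm q)" 1] by simp

lemma eval_P:
  assumes "Im z > 0"
  shows "eval_fps P (e2pii z) = f z"
  using coeff_sums[OF assms] by (simp add: eval_fps_def P_def sums_iff)

lemma coeff_summable:
  assumes "y > 0"
  shows "summable (\<lambda>n. norm (coeff n) * exp (- (2 * pi * y)) ^ n)"
proof -
  have "summable (\<lambda>n. norm (fps_nth P n * of_real (exp (- (2 * pi * y))) ^ n))"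
    by (rule abs_summable_in_conv_radius)
       (use in_conv_radius[of "of_real (exp (- (2 * pi * y))) :: complex"] assms in \<open>simp add: fps_conv_radius_def\<close>)
  then show ?thesis by (simp add: P_def norm_mult norm_power)
qed

text \<open>Cauchy's inequality on the circle |q| = e^(-2 pi/n), that is at height Im z = 1/n. The
  n-th power of this radius is e^(-2 pi), independent of n, so the polynomial bound for f passes to
  the coefficients.\<close>

lemma coeff_bound:
  obtains M where "M \<ge> 0" "\<And>n. n > 0 \<Longrightarrow> norm (coeff n) \<le> M * real n ^ k"
proof -
  obtain M where M: "M \<ge> 0" "\<And>z. 0 < Im z \<Longrightarrow> Im z \<le> 1 \<Longrightarrow> norm (f z) \<le> M / Im z ^ k"
    using polynomial_bound by blast
  show thesis
  proof (rule that)
    show "M * exp (2 * pi) \<ge> 0" using M by simp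
    fix n :: nat assume n: "n > 0"
    define r where "r = exp (- (2 * pi / real n))"
    have r: "0 < r" "r < 1" using n by (auto simp: r_def)
    have sub: "cball (0 :: complex) r \<subseteq> eball 0 (fps_conv_radius P)"
    proof
      fix x :: complex assume "x \<in> cball 0 r"
      then show "x \<in> eball 0 (fps_conv_radius P)" using in_conv_radius[of x] r by (simp add: in_eball_iff)
    qed
    have holo: "eval_fps P holomorphic_on cball 0 r" by (rule holomorphic_on_eval_fps[OF sub])
    have "norm ((deriv ^^ n) (eval_fps P) 0) \<le> fact n * (M * real n ^ k) / r ^ n"
    proof (rule Cauchy_inequality)
      show "eval_fps P holomorphic_on ball 0 r" using holo holomorphic_on_subset by force
      show "continuous_on (cball 0 r) (eval_fps P)" using holo by (rule holomorphic_on_imp_continuous_on)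
      fix q :: complex assume "norm (0 - q) = r"
      then have q: "norm q = r" by simp
      obtain z where z: "Im z > 0" "e2pii z = q" "Im z = - ln (norm q) / (2 * pi)" using e2pii_surj[of q] r q by auto
      have "Im z = 1 / real n" using z(3) unfolding q r_def by simp
      then show "norm (eval_fps P q) \<le> M * real n ^ k" using M(2)[of z] eval_P[OF z(1)] z n by (simp add: power_one_over)
    qed (use r in auto)
    also have "r ^ n = exp (- (2 * pi))" using n by (simp add: r_def flip: exp_of_nat_mult)
    finally have "norm ((deriv ^^ n) (eval_fps P) 0) / fact n \<le> M * real n ^ k / exp (- (2 * pi))"
      by (simp add: field_simps)
    moreover have "coeff n = (deriv ^^ n) (eval_fps P) 0 / fact n"
      using fps_nth_conv_deriv[of P n] conv_radius less_le_trans[of 0 1 "fps_conv_radius P"] by (simp add: P_def)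
    ultimately have "norm (coeff n) \<le> M * real n ^ k / exp (- (2 * pi))" by (simp only: norm_divide norm_fact)
    also have "\<dots> = M * exp (2 * pi) * real n ^ k" by (simp add: exp_minus field_simps)
    finally show "norm (coeff n) \<le> M * exp (2 * pi) * real n ^ k" .
  qed
qed

text \<open>With no constant term, each term of the series at height Im z is at most e^(-2 pi (Im z
  - \<eta>)) times the norm of the corresponding term at height \<eta>.\<close>

lemma decay_at_infinity:
  assumes \<eta>: "\<eta> > 0"
  obtains C where "C \<ge> 0" "\<And>z. Im z \<ge> \<eta> \<Longrightarrow> norm (f z) \<le> C * exp (- (2 * pi * Im z))"
proof
  define q where "q = exp (- (2 * pi * \<eta>))"
  define C where "C = (\<Sum>n. norm (coeff n) * q ^ n) * exp (2 * pi * \<eta>)"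
  have summ: "summable (\<lambda>n. norm (coeff n) * q ^ n)" unfolding q_def by (rule coeff_summable[OF \<eta>])
  show "C \<ge> 0" unfolding C_def by (intro mult_nonneg_nonneg suminf_nonneg summ) (auto simp: q_def)
  fix z assume z: "Im z \<ge> \<eta>"
  define e where "e = exp (- (2 * pi * (Im z - \<eta>)))"
  have e: "0 \<le> e" "e \<le> 1" using z by (auto simp: e_def)
  have qe: "norm (e2pii z) = q * e" by (simp add: norm_e2pii q_def e_def algebra_simps flip: exp_add)
  have le: "norm (coeff n * e2pii z ^ n) \<le> norm (coeff n) * q ^ n * e" for n
  proof (cases n)
    case (Suc m)
    have "e ^ n \<le> e" using e power_decreasing[of 1 n e] Suc by simp
    then have "norm (coeff n) * q ^ n * e ^ n \<le> norm (coeff n) * q ^ n * e"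
      by (intro mult_left_mono) (auto simp: q_def)
    then show ?thesis by (simp add: norm_mult norm_power qe power_mult_distrib mult_ac)
  qed (simp add: coeff_def)
  have "f z = (\<Sum>n. coeff n * e2pii z ^ n)" using coeff_sums[of z] z \<eta> by (simp add: sums_iff)
  also have "norm \<dots> \<le> (\<Sum>n. norm (coeff n) * q ^ n * e)"
    by (rule norm_suminf_le[OF le summable_mult2[OF summ]])
  also have "\<dots> = (\<Sum>n. norm (coeff n) * q ^ n) * e" by (rule suminf_mult2[OF summ, symmetric])
  also have "\<dots> = C * exp (- (2 * pi * Im z))"
    by (simp add: C_def e_def algebra_simps flip: exp_add)
  finally show "norm (f z) \<le> C * exp (- (2 * pi * Im z))" .
qed

lemma reflection:
  assumes real: "\<And>j. j \<ge> 1 \<Longrightarrow> a j \<in> \<real>" and z: "Im z > 0"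
  shows "f (- cnj z) = cnj (f z)"
proof -
  have "cnj (coeff n) = coeff n" for n using real[of n] by (auto simp: coeff_def elim!: Reals_cases)
  moreover have "e2pii (- cnj z) = cnj (e2pii z)" by (simp add: e2pii_def exp_cnj)
  moreover have "(\<lambda>n. cnj (coeff n * e2pii z ^ n)) sums cnj (f z)"
    using coeff_sums[OF z] by (subst sums_cnj)
  ultimately have "(\<lambda>n. coeff n * e2pii (- cnj z) ^ n) sums cnj (f z)" by simp
  moreover have "(\<lambda>n. coeff n * e2pii (- cnj z) ^ n) sums f (- cnj z)" using z by (intro coeff_sums) simp
  ultimately show ?thesis by (rule sums_unique2[symmetric])
qed

text \<open>As y grows, f(z)/e(z) tends to a_1, the derivative of the power series at q = 0; on a
  ray of zeros this limit would be 0.\<close>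

lemma nonzero_on_ray:
  assumes "a 1 \<noteq> 0"
  shows "\<exists>y>0. f (Complex x y) \<noteq> 0"
proof (rule ccontr)
  assume "\<not> ?thesis"
  then have f0: "\<And>y. y > 0 \<Longrightarrow> f (Complex x y) = 0" by auto
  have "((\<lambda>q. (eval_fps P q - eval_fps P 0) / (q - 0)) \<longlongrightarrow> eval_fps (fps_deriv P) 0) (at 0)"
    using has_field_derivative_eval_fps[of 0 P UNIV] in_conv_radius[of 0]
    by (simp add: has_field_derivative_iff)
  moreover have "eval_fps (fps_deriv P) 0 = a 1" by (simp add: eval_fps_at_0 P_def coeff_def)
  moreover have "eval_fps P 0 = 0" by (simp add: eval_fps_at_0 P_def coeff_def)
  ultimately have lim: "((\<lambda>q. eval_fps P q / q) \<longlongrightarrow> a 1) (at 0)" by simp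
  have "filterlim (\<lambda>n. e2pii (Complex x (real (Suc n)))) (at 0) sequentially"
  proof -
    have "(\<lambda>n. e2pii (Complex x (real (Suc n)))) \<longlonglongrightarrow> 0"
      by (rule tendsto_norm_zero_cancel) (unfold norm_e2pii complex.sel, real_asymp)
    then show ?thesis by (simp add: filterlim_at e2pii_def)
  qed
  from filterlim_compose[OF lim this] have "(\<lambda>n. 0) \<longlonglongrightarrow> a 1"
    using eval_P f0 by simp
  from LIMSEQ_unique[OF this tendsto_const] show False using assms by simp
qed

end

section \<open>The twisted L-function\<close>

lemma power_le_fact_mult_exp:
  fixes x :: real
  assumes "x \<ge> 0"
  shows "x ^ n \<le> fact n * exp x"
proof -
  have s: "(\<lambda>n. x ^ n /\<^sub>R fact n) sums exp x" by (rule exp_converges)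
  have "(\<Sum>i\<in>{n}. x ^ i /\<^sub>R fact i) \<le> (\<Sum>i. x ^ i /\<^sub>R fact i)"
    using assms by (intro sum_le_suminf sums_summable[OF s]) auto
  then have "x ^ n / fact n \<le> exp x" using sums_unique[OF s] by (simp add: divide_inverse mult.commute)
  then show ?thesis by (simp add: field_simps)
qed

text \<open>The equivalence of p/q with the infinite cusp enters only as the divisibility
  \<open>Nq\<close>, which \<open>theorem1p1\<close> extracts from it.\<close>

locale twisted_cusp_form = fourier_cusp_form +
  fixes p q :: int and m :: nat
  assumes km: "k = 2 * m" and m: "m > 0" and q: "q > 0" and Nq: "int N dvd q"
    and pq: "q dvd p\<^sup>2 - 1" and real_coeff: "\<And>j. j \<ge> 1 \<Longrightarrow> a j \<in> \<real>" and a1: "a 1 \<noteq> 0"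
begin

definition point :: "complex \<Rightarrow> complex" where
  "point u = of_int p / of_int q + \<i> * exp u / of_int q"

definition \<Phi> :: "complex \<Rightarrow> complex" where
  "\<Phi> u = (\<i> * exp u) ^ m * f (point u)"

lemma Im_point: "Im (point u) = exp (Re u) * cos (Im u) / of_int q"
proof -
  have "point u = (of_int p + \<i> * exp u) / of_real (of_int q)" by (simp add: point_def add_divide_distrib)
  then show ?thesis by (simp only: Im_divide_of_real) (simp add: Re_exp)
qed

lemma Im_point_pos: "\<bar>Im u\<bar> < pi / 2 \<Longrightarrow> Im (point u) > 0"
  using q cos_gt_zero_pi[of "Im u"] by (simp add: Im_point abs_less_iff)

lemma holomorphic_\<Phi>: "\<Phi> holomorphic_on {u. \<bar>Im u\<bar> < pi / 2}"
  unfolding \<Phi>_def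
proof (intro holomorphic_intros holomorphic_on_compose_gen[OF _ holo, unfolded o_def])
  show "point holomorphic_on {u. \<bar>Im u\<bar> < pi / 2}"
    unfolding point_def using q by (intro holomorphic_intros) auto
  show "point ` {u. \<bar>Im u\<bar> < pi / 2} \<subseteq> upper_half_plane"
    using Im_point_pos by (auto simp: upper_half_plane_def)
qed

text \<open>
  The matrix $(p, (p^2-1)/q; q, p)$ lies in $\Gamma_0(N)$ and maps $-p/q + iw/q$ to $p/q + i/(qw)$.
\<close>
lemma functional_equation:
  assumes u: "\<bar>Im u\<bar> < pi / 2"
  shows "\<Phi> (- u) = cnj (\<Phi> (cnj u))"
proof -
  define w where "w = exp u"
  have w0: "w \<noteq> 0" by (simp add: w_def)
  define Q where "Q = (of_int q :: complex)"
  have Q0: "Q \<noteq> 0" using q by (simp add: Q_def)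
  define z where "z = - cnj (point (cnj u))"
  have z_eq: "z = - (of_int p / Q) + \<i> * w / Q"
    by (simp add: z_def point_def w_def Q_def exp_cnj)
  have Im_z: "Im z > 0" using Im_point_pos[of "cnj u"] u by (simp add: z_def)
  have fz: "f z = cnj (f (point (cnj u)))"
    unfolding z_def using u by (intro reflection real_coeff Im_point_pos) auto
  obtain b where b: "p\<^sup>2 - 1 = q * b" using pq by blast
  have det: "p * p - b * q = 1" using b by (simp add: power2_eq_square mult.commute)
  have detC: "of_int p * of_int p - of_int b * Q = 1"
    using arg_cong[OF det, of "of_int :: int \<Rightarrow> complex"] by (simp add: Q_def)
  have J: "Q * z + of_int p = \<i> * w" using Q0 by (simp add: z_eq field_simps)
  have num: "of_int p * z + of_int b = (of_int p * (\<i> * w) - 1) / Q"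
  proof -
    have "(of_int p * z + of_int b) * Q = of_int p * (Q * z + of_int p) - (of_int p * of_int p - of_int b * Q)"
      by (simp add: algebra_simps)
    then have "(of_int p * z + of_int b) * Q = of_int p * (\<i> * w) - 1" by (simp only: J detC)
    then show ?thesis using Q0 by (simp add: field_simps)
  qed
  have "(of_int p * z + of_int b) / (Q * z + of_int p) = point (- u)"
    unfolding num J point_def using w0 Q0 by (simp add: exp_minus w_def[symmetric] Q_def[symmetric] field_simps)
  moreover have "f ((of_int p * z + of_int b) / (Q * z + of_int p)) = (Q * z + of_int p) ^ k * f z"
    unfolding Q_def by (rule invariant[OF det Nq Im_z])
  ultimately have "f (point (- u)) = (\<i> * w) ^ k * f z" by (simp only: J)
  then have "\<Phi> (- u) = (\<i> / w) ^ m * ((\<i> * w) ^ k * f z)"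
    by (simp add: \<Phi>_def exp_minus w_def divide_inverse)
  \<comment> \<open>Evenness of k matters here: the automorphy factor (iw)^(2m) and the prefactor
    (i/w)^m combine into the m-th power of -iw, the conjugate of the prefactor at the reflected
    point.\<close>
  also have "\<dots> = (\<i> / w * (\<i> * w)\<^sup>2) ^ m * f z"
    by (simp only: km power_mult power_mult_distrib mult.assoc)
  also have "\<i> / w * (\<i> * w)\<^sup>2 = - \<i> * w" using w0 by (simp add: power2_eq_square)
  also have "(- \<i> * w) ^ m * f z = cnj (\<Phi> (cnj u))" by (simp add: fz \<Phi>_def w_def exp_cnj)
  finally show ?thesis .
qed

lemma norm_\<Phi>: "norm (\<Phi> u) = exp (Re u) ^ m * norm (f (point u))"
  by (simp add: \<Phi>_def norm_mult norm_power)

text \<open>For Re u \<ge> 0 the height of \<open>point u\<close> grows like e^(Re u), and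
  exponential decay of f in the height beats every power of it. The functional equation carries this
  to Re u < 0. Arbitrary \<open>L\<close> is what makes \<Lambda> entire.\<close>

lemma \<Phi>_decay:
  assumes th: "0 \<le> \<theta>" "\<theta> < pi / 2"
  obtains C where "C \<ge> 0" "\<And>u. \<bar>Im u\<bar> \<le> \<theta> \<Longrightarrow> norm (\<Phi> u) \<le> C * exp (- (real L * \<bar>Re u\<bar>))"
proof -
  have cth: "cos \<theta> > 0" using th by (intro cos_gt_zero_pi) auto
  \<comment> \<open>A lower bound for the height of \<open>point u\<close> when |Im u| \<le>
    \<theta> and Re u \<ge> 0.\<close>
  define \<eta> where "\<eta> = cos \<theta> / of_int q"
  have \<eta>: "\<eta> > 0" using cth q by (simp add: \<eta>_def)
  obtain C where C: "C \<ge> 0" "\<And>z. Im z \<ge> \<eta> \<Longrightarrow> norm (f z) \<le> C * exp (- (2 * pi * Im z))"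
    using decay_at_infinity[OF \<eta>] by blast
  define \<kappa> where "\<kappa> = 2 * pi * \<eta>"
  have \<kappa>: "\<kappa> > 0" using \<eta> by (simp add: \<kappa>_def)
  \<comment> \<open>From y^n \<le> n! e^y with y = \<kappa> x and n = m + L: \<open>m\<close> for
    the prefactor of \<Phi> and \<open>L\<close> for the desired decay.\<close>
  define C' where "C' = C * (fact (m + L) / \<kappa> ^ (m + L))"
  have pos: "norm (\<Phi> u) \<le> C' * exp (- (real L * \<bar>Re u\<bar>))" if u: "\<bar>Im u\<bar> \<le> \<theta>" "Re u \<ge> 0" for u
  proof -
    define x where "x = exp (Re u)"
    have x: "x \<ge> 1" using u by (simp add: x_def)
    have "cos \<theta> \<le> cos \<bar>Im u\<bar>" using u th by (intro cos_monotone_0_pi_le) auto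
    then have "\<eta> * x \<le> Im (point u)"
      using q x by (simp add: Im_point \<eta>_def x_def[symmetric] divide_right_mono mult.commute)
    moreover have "\<eta> * 1 \<le> \<eta> * x" using \<eta> x by (intro mult_left_mono) auto
    ultimately have *: "\<eta> \<le> Im (point u)" "\<kappa> * x \<le> 2 * pi * Im (point u)" unfolding \<kappa>_def by auto
    have "norm (f (point u)) \<le> C * exp (- (2 * pi * Im (point u)))" by (rule C(2)[OF *(1)])
    also have "\<dots> \<le> C * exp (- (\<kappa> * x))" using *(2) C(1) by (intro mult_left_mono) auto
    finally have "norm (\<Phi> u) * x ^ L \<le> (x ^ m * (C * exp (- (\<kappa> * x)))) * x ^ L"
      unfolding norm_\<Phi> x_def[symmetric] using x by (intro mult_right_mono mult_left_mono) auto
    also have "\<dots> = C * x ^ (m + L) * exp (- (\<kappa> * x))" by (simp add: power_add mult_ac)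
    also have "\<dots> \<le> C'"
    proof -
      have "(\<kappa> * x) ^ (m + L) \<le> fact (m + L) * exp (\<kappa> * x)"
        using \<kappa> x by (intro power_le_fact_mult_exp) auto
      then have "x ^ (m + L) * exp (- (\<kappa> * x)) \<le> fact (m + L) / \<kappa> ^ (m + L)"
        using \<kappa> by (simp add: power_mult_distrib exp_minus field_simps)
      from mult_left_mono[OF this C(1)] show ?thesis by (simp add: C'_def mult.assoc)
    qed
    finally have "norm (\<Phi> u) * x ^ L \<le> C'" .
    moreover have "x ^ L = exp (real L * \<bar>Re u\<bar>)" using u by (simp add: x_def exp_of_nat_mult)
    ultimately show ?thesis by (simp add: exp_minus field_simps)
  qed
  show thesis
  proof (rule that)
    show "C' \<ge> 0" using C \<kappa> by (simp add: C'_def)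
    fix u assume u: "\<bar>Im u\<bar> \<le> \<theta>"
    show "norm (\<Phi> u) \<le> C' * exp (- (real L * \<bar>Re u\<bar>))"
    proof (cases "Re u \<ge> 0")
      case True then show ?thesis by (rule pos[OF u])
    next
      case False
      have "\<Phi> u = cnj (\<Phi> (cnj (- u)))" using functional_equation[of "- u"] u th by simp
      then have "norm (\<Phi> u) = norm (\<Phi> (cnj (- u)))" by (metis complex_mod_cnj)
      also have "\<dots> \<le> C' * exp (- (real L * \<bar>Re (cnj (- u))\<bar>))" by (rule pos) (use u False in auto)
      finally show ?thesis by simp
    qed
  qed
qed

sublocale strip_function \<Phi>
proof
  show "\<Phi> holomorphic_on {u. \<bar>Im u\<bar> < pi / 2}" by (rule holomorphic_\<Phi>)
  fix \<theta> :: real assume "0 \<le> \<theta>" "\<theta> < pi / 2"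
  from \<Phi>_decay[OF this, of 1] show "\<exists>C. \<forall>u. \<bar>Im u\<bar> \<le> \<theta> \<longrightarrow> norm (\<Phi> u) \<le> C * exp (- \<bar>Re u\<bar>)"
    by simp metis
qed

text \<open>On the real line the functional equation says that conjugating \<Phi> is the same as
  replacing v by -v, and conjugation does the same to the kernel.\<close>

lemma transform_real: "transform t \<in> \<real>"
proof -
  have "cnj (transform t) = (LINT v|lborel. cnj (\<Phi> (of_real v) * cis (t * v)))"
    unfolding transform_def by (rule Bochner_Integration.integral_cnj[symmetric])
  also have "\<dots> = (LINT v|lborel. \<Phi> (of_real (- v)) * cis (t * (- v)))"
    using functional_equation[of "of_real _"] by (simp add: cis_cnj)
  also have "\<dots> = transform t"
    unfolding transform_def
    using lborel_integral_real_affine[of "- 1" "\<lambda>v. \<Phi> (of_real v) * cis (t * v)" 0] by simp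
  finally show ?thesis by (simp add: Reals_cnj_iff)
qed

text \<open>As \<theta> tends to pi/2, \<open>point (Complex v \<theta>)\<close> moves on a circle
  about p/q to the real point (p - e^v)/q. This is a rational cusp, and the approach stays within
  the cone of \<open>cusp_limit\<close>.\<close>

lemma \<Phi>_tendsto_0:
  assumes "exp v \<in> \<rat>"
  shows "((\<lambda>\<theta>. \<Phi> (Complex v \<theta>)) \<longlongrightarrow> 0) (at_left (pi / 2))"
proof -
  define \<rho> where "\<rho> = exp v / of_int q"
  have \<rho>: "\<rho> > 0" using q by (simp add: \<rho>_def)
  have "of_int p / of_int q - \<rho> \<in> \<rat>" using assms by (simp add: \<rho>_def)
  then obtain A c :: int where Ac: "c > 0" "coprime A c" "of_int p / of_int q - \<rho> = of_int A / of_int c"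
    by (elim Rats_cases') auto
  define x :: complex where "x = of_int A / of_int c"
  have x: "x = of_real (of_int p / of_int q - \<rho>)" unfolding Ac(3) x_def by simp
  have point: "point (Complex v \<theta>) - x = Complex (\<rho> * (1 - sin \<theta>)) (\<rho> * cos \<theta>)" for \<theta>
    unfolding x point_def using q
    by (simp add: complex_eq_iff exp_eq_polar \<rho>_def Re_divide Im_divide field_simps power2_eq_square)
  define S where "S = {z. norm (z - x) \<le> 2 * Im z}"
  have "filterlim (\<lambda>\<theta>. point (Complex v \<theta>)) (at x within S) (at_left (pi / 2))"
    unfolding filterlim_at
  proof
    have "((\<lambda>\<theta>. x + Complex (\<rho> * (1 - sin \<theta>)) (\<rho> * cos \<theta>)) \<longlongrightarrow> x + Complex (\<rho> * (1 - sin (pi / 2))) (\<rho> * cos (pi / 2))) (at_left (pi / 2))"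
      by (intro tendsto_intros)
    moreover have "x + Complex (\<rho> * (1 - sin (pi / 2))) (\<rho> * cos (pi / 2)) = x" by (simp add: complex_eq_iff)
    ultimately show "((\<lambda>\<theta>. point (Complex v \<theta>)) \<longlongrightarrow> x) (at_left (pi / 2))"
      unfolding point[symmetric] by simp
    show "\<forall>\<^sub>F \<theta> in at_left (pi / 2). point (Complex v \<theta>) \<in> S \<and> point (Complex v \<theta>) \<noteq> x"
      using eventually_at_left_real[of 0 "pi / 2", OF pi_half_gt_zero]
    proof eventually_elim
      case (elim \<theta>)
      have sc: "sin \<theta> > 0" "cos \<theta> > 0" using elim by (auto intro!: sin_gt_zero cos_gt_zero_pi)
      \<comment> \<open>From 1 \<le> sin \<theta> + cos \<theta> the horizontal distance \<rho>(1 -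
        sin \<theta>) is at most the height \<rho> cos \<theta>; adding the two gives the constant 2
        of the cone.\<close>
      have "(sin \<theta> + cos \<theta>)\<^sup>2 = 1 + 2 * sin \<theta> * cos \<theta>"
        using sin_cos_squared_add[of \<theta>] by (simp add: power2_sum)
      then have "1\<^sup>2 \<le> (sin \<theta> + cos \<theta>)\<^sup>2" using sc by simp
      then have "1 \<le> sin \<theta> + cos \<theta>" by (rule power2_le_imp_le) (use sc in auto)
      then have "\<rho> * (1 - sin \<theta>) \<le> \<rho> * cos \<theta>" using \<rho> by (intro mult_left_mono) auto
      moreover have "\<rho> * (1 - sin \<theta>) \<ge> 0" "\<rho> * cos \<theta> > 0" using \<rho> sc by auto
      ultimately have "norm (point (Complex v \<theta>) - x) \<le> 2 * (\<rho> * cos \<theta>)"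
        using cmod_le[of "point (Complex v \<theta>) - x"] unfolding point by simp
      moreover have Im: "Im (point (Complex v \<theta>)) = \<rho> * cos \<theta>" by (simp add: Im_point \<rho>_def)
      moreover have "Im x = 0" by (simp add: x)
      ultimately show ?case using \<open>\<rho> * cos \<theta> > 0\<close> by (auto simp: S_def)
    qed
  qed
  from filterlim_compose[OF cusp_limit[OF Ac(2,1)] this[unfolded S_def x_def]]
  have "((\<lambda>\<theta>. f (point (Complex v \<theta>))) \<longlongrightarrow> 0) (at_left (pi / 2))" .
  then have "((\<lambda>\<theta>. (\<i> * exp (Complex v \<theta>)) ^ m * f (point (Complex v \<theta>))) \<longlongrightarrow> (\<i> * exp (Complex v (pi / 2))) ^ m * 0) (at_left (pi / 2))"
    by (intro tendsto_intros)
  then show ?thesis by (simp add: \<Phi>_def)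
qed

lemma dense_log_rationals: "closure {v :: real. exp v \<in> \<rat>} = UNIV"
proof -
  have "v \<in> closure {v :: real. exp v \<in> \<rat>}" for v :: real
    unfolding closure_approachable
  proof (intro allI impI)
    fix e :: real assume e: "e > 0"
    obtain r where r: "r \<in> \<rat>" "exp (v - e) < r" "r < exp v" using Rats_dense_in_real[of "exp (v - e)" "exp v"] e by auto
    have r0: "r > 0" using r(2) exp_gt_zero[of "v - e"] by linarith
    have "exp (v - e) < exp (ln r)" "exp (ln r) < exp v" using r r0 by auto
    then have "v - e < ln r" "ln r < v" by (simp_all only: exp_less_cancel_iff)
    then show "\<exists>y\<in>{v. exp v \<in> \<rat>}. dist y v < e"
      using r r0 by (intro bexI[of _ "ln r"]) (auto simp: dist_real_def)
  qed
  then show ?thesis by blast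
qed

lemma infinite_transform_zeros: "infinite {t. transform t = 0}"
proof -
  have unbounded: "\<exists>t\<ge>T. transform t = 0" for T
  proof (rule transform_zeros_unbounded[where D = "{v. exp v \<in> \<rat>}"])
    obtain y where y: "y > 0" "f (Complex (of_int p / of_int q) y) \<noteq> 0" using nonzero_on_ray[OF a1] by blast
    \<comment> \<open>The real u for which \<open>point u\<close> is the point of height y above
      p/q.\<close>
    define u :: complex where "u = of_real (ln (of_int q * y))"
    have "exp u = of_real (of_int q * y)" unfolding u_def exp_of_real using y q by simp
    then have "point u = Complex (of_int p / of_int q) y" using q by (simp add: point_def complex_eq_iff Re_divide Im_divide power2_eq_square)
    then have "\<Phi> u \<noteq> 0" using y by (simp add: \<Phi>_def)
    moreover have "\<bar>Im u\<bar> < pi / 2" by (simp add: u_def)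
    ultimately show "\<exists>u. \<bar>Im u\<bar> < pi / 2 \<and> \<Phi> u \<noteq> 0" by blast
  qed (use transform_real dense_log_rationals \<Phi>_tendsto_0 in auto)
  show ?thesis
  proof
    assume fin: "finite {t. transform t = 0}"
    obtain t where "t \<ge> Max {t. transform t = 0} + 1" "transform t = 0" using unbounded by blast
    then show False using Max_ge[OF fin, of t] by simp
  qed
qed

section \<open>The completed L-function and its Dirichlet series\<close>

definition \<Lambda> :: "complex \<Rightarrow> complex" where
  "\<Lambda> s = (LINT v|lborel. \<Phi> (of_real v) * exp ((s - 1 / 2) * of_real v))"

text \<open>With S = s + m - 1/2, \<Lambda>(s) is i^m Gamma(S) (2 pi/q)^(-S) times the twisted
  L-function. Dividing by Gamma through the entire function \<open>rGamma\<close> makes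
  \<open>L\<close> visibly entire, and zeros of \<Lambda> are zeros of \<open>L\<close>.\<close>

definition L :: "complex \<Rightarrow> complex" where
  "L s = \<Lambda> s / \<i> ^ m * (rGamma (s + of_nat m - 1 / 2) * of_real (2 * pi / of_int q) powr (s + of_nat m - 1 / 2))"

lemma continuous_\<Phi>_real: "continuous_on UNIV (\<lambda>v. \<Phi> (of_real v))"
  using continuous_on_line[of 0 UNIV] by (simp add: complex_of_real_def)

lemma holomorphic_\<Lambda>: "\<Lambda> holomorphic_on UNIV"
proof -
  have "(\<lambda>s. LINT v|lborel. \<Phi> (of_real v) * exp (s * of_real v)) holomorphic_on UNIV"
  proof (rule holomorphic_exponential_integral[OF continuous_\<Phi>_real])
    fix l :: nat
    have "0 < pi / 2" by simp
    from \<Phi>_decay[OF order_refl this, of l] obtain C where C: "C \<ge> 0" "\<And>u. \<bar>Im u\<bar> \<le> 0 \<Longrightarrow> norm (\<Phi> u) \<le> C * exp (- (real l * \<bar>Re u\<bar>))"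
      by metis
    show "\<exists>C\<ge>0. \<forall>v. norm (\<Phi> (of_real v)) \<le> C * exp (- (real l * \<bar>v\<bar>))"
      using C(1) C(2)[of "of_real _"] by (intro exI[of _ C]) simp
  qed
  moreover have "(\<lambda>s. s - 1 / 2) holomorphic_on (UNIV :: complex set)" by (intro holomorphic_intros)
  ultimately show ?thesis
    unfolding \<Lambda>_def using holomorphic_on_compose_gen[of "\<lambda>s. s - 1 / 2" UNIV _ UNIV] by (simp add: o_def)
qed

lemma \<Lambda>_critical_line: "\<Lambda> (Complex (1 / 2) t) = transform t"
proof -
  have "Complex (1 / 2) t - 1 / 2 = \<i> * of_real t" by (simp add: complex_eq_iff)
  then show ?thesis unfolding \<Lambda>_def transform_def cis_conv_exp by (simp add: mult.assoc)
qed

lemma holomorphic_L: "L holomorphic_on UNIV"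
proof -
  have "(\<lambda>s. rGamma (s + of_nat m - 1 / 2)) holomorphic_on UNIV"
    by (rule holomorphic_on_compose_gen[OF _ holomorphic_rGamma[of UNIV], unfolded o_def]) (auto intro!: holomorphic_intros)
  then show ?thesis
    unfolding L_def using q by (intro holomorphic_intros holomorphic_\<Lambda>) auto
qed

text \<open>Insert the Fourier series of f at \<open>point v\<close> into \<Lambda> and integrate
  term by term; each term is a Gamma integral with c = 2 pi n/q, and the real part p/q of the point
  produces the twist.\<close>

lemma Dirichlet_series:
  assumes s: "Re s > real k + 2"
  shows "(\<lambda>n. a (Suc n) * e2pii (of_nat (Suc n) * (of_int p / of_int q)) * of_nat (Suc n) powr (- s)) sums L s"
proof -
  \<comment> \<open>The prefactor of \<Phi> contributes e^(mv), which joins the kernel e^((s -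
    1/2)v).\<close>
  define S where "S = s + of_nat m - 1 / 2"
  define \<sigma> where "\<sigma> = Re S"
  have \<sigma>: "\<sigma> > real k + 1" using s by (simp add: \<sigma>_def S_def)
  then have S: "Re S > 0" by (simp add: \<sigma>_def)
  define \<zeta> where "\<zeta> n = e2pii (of_nat n * (of_int p / of_int q))" for n :: nat
  have norm_\<zeta>: "norm (\<zeta> n) = 1" for n by (simp add: \<zeta>_def norm_e2pii Im_divide)
  define r where "r = 2 * pi / of_int q"
  have r: "r > 0" using q by (simp add: r_def)
  define T where "T n v = coeff n * \<zeta> n * exp (S * of_real v - of_real (r * real n * exp v))" for n :: nat and v :: real
  have T0: "T 0 = (\<lambda>v. 0)" by (simp add: T_def fun_eq_iff coeff_def)
  have T_sums: "(\<lambda>n. T n v) sums (\<Phi> (of_real v) * exp ((s - 1 / 2) * of_real v) / \<i> ^ m)" for v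
  proof -
    have "(\<lambda>n. coeff n * e2pii (point (of_real v)) ^ n * exp (S * of_real v)) sums (f (point (of_real v)) * exp (S * of_real v))"
      by (intro sums_mult2 coeff_sums Im_point_pos) simp
    moreover have "coeff n * e2pii (point (of_real v)) ^ n * exp (S * of_real v) = T n v" for n
    proof -
      have "point (of_real v) = of_real (of_int p / of_int q) + \<i> * of_real (exp v / of_int q)"
        by (simp add: point_def exp_of_real)
      then have "2 * of_real pi * \<i> * (of_nat n * point (of_real v))
        = 2 * of_real pi * \<i> * (of_nat n * of_real (of_int p / of_int q)) + - of_real (r * real n * exp v)"
        by (simp add: complex_eq_iff r_def)
      then have "2 * of_real pi * \<i> * (of_nat n * point (of_real v))
        = 2 * of_real pi * \<i> * (of_nat n * (of_int p / of_int q)) + - of_real (r * real n * exp v)"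
        by simp
      then have "e2pii (point (of_real v)) ^ n = \<zeta> n * exp (- of_real (r * real n * exp v))"
        unfolding e2pii_power[symmetric] unfolding \<zeta>_def e2pii_def by (simp only: exp_add)
      then show ?thesis by (simp add: T_def exp_diff exp_minus divide_inverse mult_ac)
    qed
    moreover have "\<Phi> (of_real v) * exp ((s - 1 / 2) * of_real v) / \<i> ^ m = f (point (of_real v)) * exp (S * of_real v)"
    proof -
      have "exp (of_real v) ^ m * exp ((s - 1 / 2) * of_real v) = exp (S * of_real v)"
        by (simp add: S_def exp_of_nat_mult[symmetric] exp_add[symmetric] algebra_simps)
      then show ?thesis by (simp add: \<Phi>_def power_mult_distrib mult_ac)
    qed
    ultimately show ?thesis by simp
  qed
  have c: "r * real n > 0" if "n > 0" for n using r that by simp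
  have T_int: "integrable lborel (T n)" for n
  proof (cases "n = 0")
    case False
    then show ?thesis unfolding T_def[abs_def] by (intro integrable_mult_right Gamma_log_integral(1)[OF S c]) simp
  qed (simp add: T0)
  define K where "K = norm (Gamma (of_real \<sigma> :: complex))"
  \<comment> \<open>Taking norms replaces S by its real part \<sigma> and removes the twist, so the
    L1 norm is again a Gamma integral.\<close>
  have T_norm: "(LINT v|lborel. norm (T n v)) = norm (coeff n) * (K * (r * real n) powr (- \<sigma>))" for n
  proof (cases "n = 0")
    case False
    then have n: "n > 0" by simp
    have nT: "norm (T n v) = norm (coeff n) * exp (\<sigma> * v - r * real n * exp v)" for v
      by (simp add: T_def norm_mult norm_\<zeta> \<sigma>_def)
    have "of_real (LINT v|lborel. exp (\<sigma> * v - r * real n * exp v)) = (LINT v|lborel. exp (of_real \<sigma> * of_real v - of_real (r * real n * exp v)) :: complex)"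
      unfolding integral_complex_of_real[symmetric] by (simp flip: exp_of_real)
    also have "\<dots> = Gamma (of_real \<sigma>) * of_real (r * real n) powr (- of_real \<sigma>)"
      using S by (intro Gamma_log_integral(2) c n) (simp add: \<sigma>_def)
    finally have "norm (of_real (LINT v|lborel. exp (\<sigma> * v - r * real n * exp v)) :: complex) = K * (r * real n) powr (- \<sigma>)"
      using c[OF n] by (simp add: K_def norm_mult norm_powr_real_powr)
    then have "(LINT v|lborel. exp (\<sigma> * v - r * real n * exp v)) = K * (r * real n) powr (- \<sigma>)"
      by (simp add: integral_nonneg)
    then show ?thesis unfolding nT by simp
  qed (simp add: T0 coeff_def)
  obtain M where M: "M \<ge> 0" "\<And>n. n > 0 \<Longrightarrow> norm (coeff n) \<le> M * real n ^ k" using coeff_bound by blast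
  have T_summable: "summable (\<lambda>n. LINT v|lborel. norm (T n v))"
  proof (rule summable_comparison_test')
    \<comment> \<open>The coefficient bound n^k against n^(-\<sigma>): the range of s was chosen so
      that \<sigma> > k + 1.\<close>
    show "summable (\<lambda>n. M * K * r powr (- \<sigma>) * real n powr (real k - \<sigma>))"
      using \<sigma> by (intro summable_mult) (simp add: summable_real_powr_iff)
    fix n :: nat assume "n \<ge> 1"
    then have n: "n > 0" by simp
    have "norm (coeff n) * (K * (r * real n) powr (- \<sigma>)) \<le> M * real n ^ k * (K * (r * real n) powr (- \<sigma>))"
      using M(2)[OF n] by (intro mult_right_mono) (auto simp: K_def)
    also have "\<dots> = M * K * r powr (- \<sigma>) * real n powr (real k - \<sigma>)"
      using r n by (simp add: powr_mult powr_diff powr_minus powr_realpow divide_inverse mult_ac)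
    finally show "norm (LINT v|lborel. norm (T n v)) \<le> M * K * r powr (- \<sigma>) * real n powr (real k - \<sigma>)"
      unfolding T_norm by (simp add: K_def)
  qed
  have T_abs: "summable (\<lambda>n. norm (T n v))" for v
  proof -
    have "summable (\<lambda>n. norm (coeff n) * exp (- (2 * pi * (exp v / of_int q))) ^ n * exp (\<sigma> * v))"
      using q by (intro summable_mult2 coeff_summable) simp
    moreover have "norm (T n v) = norm (coeff n) * exp (- (2 * pi * (exp v / of_int q))) ^ n * exp (\<sigma> * v)" for n
      by (simp add: T_def norm_mult norm_\<zeta> \<sigma>_def r_def exp_of_nat_mult[symmetric] mult.assoc mult_ac flip: exp_add)
    ultimately show ?thesis by simp
  qed
  have "(\<lambda>n. LINT v|lborel. T n v) sums (LINT v|lborel. (\<Sum>n. T n v))"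
    by (rule sums_integral) (use T_int T_abs T_summable in auto)
  also have "(LINT v|lborel. (\<Sum>n. T n v)) = \<Lambda> s / \<i> ^ m"
    unfolding sums_unique[OF T_sums, symmetric] \<Lambda>_def by simp
  finally have "(\<lambda>n. (LINT v|lborel. T n v) * (rGamma S * of_real r powr S)) sums L s"
    unfolding L_def S_def r_def by (intro sums_mult2)
  moreover have "(LINT v|lborel. T n v) * (rGamma S * of_real r powr S) =
      (if n = 0 then 0 else a n * \<zeta> n * of_nat n powr (- s))" for n
  proof (cases "n = 0")
    case False
    then have n: "n > 0" by simp
    have G: "Gamma S \<noteq> 0" using S by (auto simp: Gamma_eq_zero_iff elim!: nonpos_Ints_cases)
    have "(LINT v|lborel. T n v) = coeff n * \<zeta> n * (Gamma S * of_real (r * real n) powr (- S))"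
      unfolding T_def using Gamma_log_integral(2)[OF S c[OF n]] by simp
    also have "of_real (r * real n) powr (- S) = of_real r powr (- S) * (of_nat n powr (- S) :: complex)"
      using r by (simp add: powr_times_real)
    finally have "(LINT v|lborel. T n v) * (rGamma S * of_real r powr S) =
      coeff n * \<zeta> n * of_nat n powr (- S) * ((Gamma S * rGamma S) * (of_real r powr (- S) * of_real r powr S))"
      by (simp only: mult_ac)
    also have "Gamma S * rGamma S = 1" using G by (simp add: rGamma_inverse_Gamma)
    also have "of_real r powr (- S) * of_real r powr S = (1 :: complex)" using r by (simp add: powr_minus)
    also have "coeff n * \<zeta> n * of_nat n powr (- S) * (1 * 1) = a n * \<zeta> n * (of_real (real n powr ((real k - 1) / 2)) * of_nat n powr (- S))"
      using n by (simp add: coeff_def mult_ac)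
    \<comment> \<open>Since k = 2m, the exponent (k - 1)/2 equals m - 1/2, exactly the shift between
      S and s.\<close>
    also have "of_real (real n powr ((real k - 1) / 2)) * of_nat n powr (- S) = (of_nat n powr (- s) :: complex)"
    proof -
      have "of_real (real n powr ((real k - 1) / 2)) = (of_nat n powr of_real ((real k - 1) / 2) :: complex)"
        using powr_of_real[of "real n" "(real k - 1) / 2"] by simp
      moreover have "of_real ((real k - 1) / 2) + - S = - s" by (simp add: S_def km field_simps)
      ultimately show ?thesis by (simp only: powr_add[symmetric])
    qed
    finally show ?thesis using False by simp
  qed (simp add: T0)
  ultimately have "(\<lambda>n. if n = 0 then 0 else a n * \<zeta> n * of_nat n powr (- s)) sums L s" by simp
  then have "(\<lambda>n. if Suc n = 0 then 0 else a (Suc n) * \<zeta> (Suc n) * of_nat (Suc n) powr (- s)) sums L s"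
    by (subst sums_Suc_iff) simp
  then show ?thesis by (simp add: \<zeta>_def)
qed

lemma twisted_L_eq: "twisted_L a (of_int p / of_int q) = L"
proof -
  have *: "continues_twisted_series a (of_int p / of_int q) L"
    unfolding continues_twisted_series_def
    using holomorphic_L Dirichlet_series by (auto simp: of_rat_divide intro!: exI[of _ "real k + 2"])
  show ?thesis
    unfolding twisted_L_def by (rule the_equality[where a = L]) (use * continues_twisted_series_unique in blast)+
qed

theorem infinite_critical_zeros:
  "infinite {s. Re s = 1 / 2 \<and> twisted_L a (of_int p / of_int q) s = 0}"
proof
  assume fin: "finite {s. Re s = 1 / 2 \<and> twisted_L a (of_int p / of_int q) s = 0}"
  have "Complex (1 / 2) ` {t. transform t = 0} \<subseteq> {s. Re s = 1 / 2 \<and> twisted_L a (of_int p / of_int q) s = 0}"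
    by (auto simp: twisted_L_eq L_def \<Lambda>_critical_line)
  then have "finite (Complex (1 / 2) ` {t. transform t = 0})" using fin by (rule finite_subset)
  then have "finite {t. transform t = 0}" by (rule finite_imageD) (auto intro: inj_onI)
  then show False using infinite_transform_zeros by blast
qed

end

theorem theorem1p1:
  fixes k N :: nat and p q :: int
    and f :: "complex \<Rightarrow> complex" and a :: "nat \<Rightarrow> complex"
  assumes "even k" and "k > 0" and "N > 0"
    and "coprime p q" and "q > 0"
    and "Gamma0_equiv_infinity N (of_int p / of_int q)"
    and "[p\<^sup>2 = 1] (mod q)"
    and "f \<in> cusp_forms k N"
    and "has_normalized_fourier_expansion k f a"
    and "a 1 \<noteq> 0" and "\<And>j. j \<ge> 1 \<Longrightarrow> a j \<in> \<real>"
  shows "infinite {s. Re s = 1 / 2 \<and> twisted_L a (of_int p / of_int q) s = 0}"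
proof -
  obtain m where m: "k = 2 * m" using assms(1) by blast
  obtain A :: "int^2^2" where A: "A \<in> Gamma0 N" "A $ 2 $ 1 \<noteq> 0"
    and eq: "(of_int p / of_int q :: rat) = of_int (A $ 1 $ 1) / of_int (A $ 2 $ 1)"
    using assms(6) unfolding Gamma0_equiv_infinity_def by blast
  have det: "A $ 1 $ 1 * A $ 2 $ 2 - A $ 1 $ 2 * A $ 2 $ 1 = 1" and NA: "int N dvd A $ 2 $ 1"
    using A(1) by (auto simp: Gamma0_def SL2Z_def det_2)
  \<comment> \<open>Writing p/q = a/c with (a, c) the first column gives pc = qa. As c is coprime to
    a, it divides q, and N divides c.\<close>
  have "(of_int (p * A $ 2 $ 1) :: rat) = of_int (q * A $ 1 $ 1)"
    using eq A(2) assms(5) by (simp add: field_simps)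
  then have "p * A $ 2 $ 1 = q * A $ 1 $ 1" by (simp only: of_int_eq_iff)
  then have "A $ 2 $ 1 dvd q * A $ 1 $ 1" by (metis dvd_triv_right)
  moreover have "coprime (A $ 2 $ 1) (A $ 1 $ 1)"
  proof (rule coprimeI)
    fix d assume d: "d dvd A $ 2 $ 1" "d dvd A $ 1 $ 1"
    then have "d dvd A $ 1 $ 1 * A $ 2 $ 2 - A $ 1 $ 2 * A $ 2 $ 1" by (intro dvd_diff dvd_mult2 dvd_mult)
    then show "is_unit d" by (simp only: det)
  qed
  ultimately have "A $ 2 $ 1 dvd q" by (simp add: coprime_dvd_mult_left_iff)
  then have Nq: "int N dvd q" using NA by (rule dvd_trans[rotated])
  interpret twisted_cusp_form k N f a p q m
  proof
    show "q dvd p\<^sup>2 - 1" using assms(7) by (simp add: cong_iff_dvd_diff)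
  qed (use assms m Nq in auto)
  show ?thesis by (rule infinite_critical_zeros)
qed

end
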